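(* Let $\varepsilon>0$, $0<\delta<1$, $s\ge 0$ and $k\ge 1$ be given, and let $c$ be a positive integer with $c\ge (s+2)/(\delta k)$. For $n\ge 1$ let $m\ge(1+\varepsilon)n$ and $\ell=n^\delta$. Let $S\subseteq U$ with $|S|=n$. Then for $(h_1,h_2)$ chosen uniformly at random from $\mathcal{Z}^{2k,c}_{\ell,m}$, $$\Pr\bigl(\mathrm{ex}(G(S,h_1,h_2))\ge s+1\bigr)=O(1/n^{s+1}).$$
   Context: $U$ is a finite set (the universe). For integers $\kappa\ge 2$, $r\ge1$, $\mathcal{H}^\kappa_r$ denotes an arbitrary $\kappa$-wise independent family of hash functions $U\to[r]=\{0,\dots,r-1\}$, i.e. for all distinct $x_1,\dots,x_\kappa\in U$ and all $j_1,\dots,j_\kappa\in[r]$, $\Pr_{h\in\mathcal{H}^\kappa_r}(h(x_1)=j_1\wedge\dots\wedge h(x_\kappa)=j_\kappa)=r^{-\kappa}$. The family $\mathcal{Z}^{2k,c}_{\ell,m}$ consists of all pairs $(h_1,h_2)$ determined by $f_1,f_2\in\mathcal{H}^{2k}_m$, $g_1,\dots,g_c\in\mathcal{H}^{2k}_\ell$ and vectors $z^{(i)}_j\in[m]^\ell$ ($1\le j\le c$, $i\in\{1,2\}$) via $h_i(x)=\bigl(f_i(x)+\sum_{j=1}^c z^{(i)}_j[g_j(x)]\bigr)\bmod m$; choosing uniformly from this family means choosing all components independently and uniformly. For $T\subseteq U$, the cuckoo graph $G(T,h_1,h_2)$ is the bipartite multigraph whose two vertex sides are copies of $[m]$ and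 whose edge multiset consists of the pairs $(h_1(x),h_2(x))$, $x\in T$. The excess $\mathrm{ex}(G)$ of a graph $G$ is the minimum number of edges one has to remove from $G$ so that every connected component of the remaining graph is acyclic or unicyclic. Constants in the $O$-notation may depend on $\varepsilon,\delta,s,k,c$. *)

theory Defs
  imports "HOL-Probability.Probability"
begin

section \<open>Undirected multigraphs and their excess\<close>

text \<open>
  Edges are abstract names and \<open>ends e\<close> is the set of end points of \<open>e\<close>
  (a singleton for a loop), so distinct edges may be parallel.
\<close>

record ('v, 'e) multigraph =
  verts :: "'v set"
  edges :: "'e set"
  ends :: "'e \<Rightarrow> 'v set"

definition adjacency :: "('v, 'e) multigraph \<Rightarrow> 'v rel" where
  "adjacency G = {(u, v). \<exists>e\<in>edges G. ends G e = {u, v}}"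

definition components :: "('v, 'e) multigraph \<Rightarrow> 'v set set" where
  "components G = verts G // {(u, v) \<in> verts G \<times> verts G. (u, v) \<in> (adjacency G)\<^sup>*}"

text \<open>
  A cycle is identified with its edge set, so that rotations and reversals of the same cyclic
  walk count only once. Two parallel edges form a cycle of length 2, a loop one of length 1.
\<close>

definition is_cycle :: "('v, 'e) multigraph \<Rightarrow> 'e set \<Rightarrow> bool" where
  "is_cycle G C \<longleftrightarrow> (\<exists>vs es.
     es \<noteq> [] \<and> length vs = length es \<and> distinct vs \<and> distinct es \<and>
     set vs \<subseteq> verts G \<and> set es \<subseteq> edges G \<and>
     (\<forall>i<length es. ends G (es ! i) = {vs ! i, vs ! (Suc i mod length es)}) \<and>
     C = set es)"

definition component_cycles :: "('v, 'e) multigraph \<Rightarrow> 'v set \<Rightarrow> 'e set set" where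
  "component_cycles G K = {C. is_cycle G C \<and> (\<forall>e\<in>C. ends G e \<subseteq> K)}"

definition acyclic_component :: "('v, 'e) multigraph \<Rightarrow> 'v set \<Rightarrow> bool" where
  "acyclic_component G K \<longleftrightarrow> component_cycles G K = {}"

definition unicyclic_component :: "('v, 'e) multigraph \<Rightarrow> 'v set \<Rightarrow> bool" where
  "unicyclic_component G K \<longleftrightarrow> (\<exists>!C. C \<in> component_cycles G K)"

definition remove_edges :: "('v, 'e) multigraph \<Rightarrow> 'e set \<Rightarrow> ('v, 'e) multigraph" where
  "remove_edges G R = G\<lparr>edges := edges G - R\<rparr>"

text \<open>
  For a finite edge set the minimum exists, since one may remove all edges.
\<close>

definition excess :: "('v, 'e) multigraph \<Rightarrow> nat" where
  "excess G = (LEAST q. \<exists>R\<subseteq>edges G. finite R \<and> card R = q \<and>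
     (\<forall>K\<in>components (remove_edges G R).
        acyclic_component (remove_edges G R) K \<or> unicyclic_component (remove_edges G R) K))"

text \<open>
  The edge multiset \<open>(h1 x, h2 x)\<close>, \<open>x \<in> T\<close>, is represented by using the keys as edge names;
  \<open>Inl\<close> and \<open>Inr\<close> provide the two copies of \<open>{..<m}\<close>.
\<close>

definition cuckoo_graph ::
    "nat \<Rightarrow> 'a set \<Rightarrow> ('a \<Rightarrow> nat) \<Rightarrow> ('a \<Rightarrow> nat) \<Rightarrow> (nat + nat, 'a) multigraph" where
  "cuckoo_graph m T h1 h2 =
     \<lparr>verts = Inl ` {..<m} \<union> Inr ` {..<m}, edges = T, ends = (\<lambda>x. {Inl (h1 x), Inr (h2 x)})\<rparr>"

section \<open>Hash families\<close>

text \<open>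
  A family may contain a function repeatedly, hence the multiset; a uniform choice respects
  multiplicities. Values of the functions outside the universe \<open>U\<close> are irrelevant.
\<close>

definition indep_hash_family ::
    "nat \<Rightarrow> nat \<Rightarrow> 'a set \<Rightarrow> ('a \<Rightarrow> nat) multiset \<Rightarrow> bool" where
  "indep_hash_family \<kappa> r U H \<longleftrightarrow>
     H \<noteq> {#} \<and> (\<forall>h\<in>#H. h \<in> U \<rightarrow> {..<r}) \<and>
     (\<forall>xs js. length xs = \<kappa> \<and> distinct xs \<and> set xs \<subseteq> U \<and> length js = \<kappa> \<and> set js \<subseteq> {..<r} \<longrightarrow>
        measure_pmf.prob (pmf_of_multiset H) {h. \<forall>i<\<kappa>. h (xs ! i) = js ! i} = 1 / real r ^ \<kappa>)"

definition Z_hash ::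
    "nat \<Rightarrow> nat \<Rightarrow> ('a \<Rightarrow> nat) \<Rightarrow> (nat \<Rightarrow> 'a \<Rightarrow> nat) \<Rightarrow> (nat \<Rightarrow> nat \<Rightarrow> nat) \<Rightarrow> 'a \<Rightarrow> nat" where
  "Z_hash c m f g z x = (f x + (\<Sum>j=1..c. z j (g j x))) mod m"

text \<open>
  The pair \<open>(h1, h2)\<close> for independent and uniform components: \<open>f1\<close>, \<open>f2\<close> from \<open>F\<close>,
  \<open>g 1, \<dots>, g c\<close> from \<open>G\<close> (shared by \<open>h1\<close> and \<open>h2\<close>), and vectors \<open>z1 j\<close>, \<open>z2 j\<close>
  of length \<open>l\<close> over \<open>{..<m}\<close>.
\<close>

definition Z_pmf ::
    "nat \<Rightarrow> nat \<Rightarrow> nat \<Rightarrow> ('a \<Rightarrow> nat) multiset \<Rightarrow> ('a \<Rightarrow> nat) multiset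
       \<Rightarrow> (('a \<Rightarrow> nat) \<times> ('a \<Rightarrow> nat)) pmf" where
  "Z_pmf c l m F G = do {
     f1 \<leftarrow> pmf_of_multiset F;
     f2 \<leftarrow> pmf_of_multiset F;
     g \<leftarrow> Pi_pmf {1..c} undefined (\<lambda>_. pmf_of_multiset G);
     z1 \<leftarrow> Pi_pmf {1..c} undefined (\<lambda>_. pmf_of_set ({..<l} \<rightarrow>\<^sub>E {..<m}));
     z2 \<leftarrow> Pi_pmf {1..c} undefined (\<lambda>_. pmf_of_set ({..<l} \<rightarrow>\<^sub>E {..<m}));
     return_pmf (Z_hash c m f1 g z1, Z_hash c m f2 g z2)
   }"

end

theory Submission
  imports Defs
begin

text \<open>
  A graph all of whose edges can be oriented with out-degree at most one has at most one cycle
  per component. Hence, if the excess exceeds \<open>s\<close>, one can greedily find \<open>s + 1\<close> ears: paths of fresh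
  vertices together with two additional edges that end in known vertices. Their keys form a list of
  length \<open>t\<close> spanning at most \<open>t - s - 1\<close> vertices, and every suffix of the list of length \<open>t'\<close>
  spans at most \<open>t' + 1\<close> vertices. The number of possible hash values of such a list is
  \<open>m ^ (t - s - 1)\<close>, resp. \<open>m ^ (t' + 1)\<close>, times a polynomial in the length.

  For a list \<open>T\<close> whose deficiency \<open>min\<^sub>j (|T| - |g\<^sub>j(T)|)\<close> is at most \<open>k\<close> the hash values are
  uniform and independent, so the union bound over the \<open>n ^ t\<close> lists gives a convergent series times
  \<open>n powr - (s + 1)\<close>. If the deficiency is larger, some suffix has deficiency exactly \<open>k\<close>; it is still
  hashed uniformly, and the loss of a factor \<open>n ^ (s + 2)\<close> is made up for by the probability
  \<open>(t' ^ (2 * k) / l ^ k) ^ c\<close> of such a deficiency.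
\<close>

section \<open>Orientations and cycles\<close>

text \<open>Ordered lists bring \<open>n ^ t\<close> choices of keys with no factorial to divide by.
  Ears make up for it: along a path one end of each new edge is dictated, so the values cost one
  factor \<open>m\<close> per vertex, and only the boundedly many moves that start or close a path
  cost polynomial factors. Dividing by \<open>m ^ (2 * t)\<close> leaves \<open>(n / m) ^ t\<close>
  times \<open>m ^ (s + 1)\<close> in the denominator. The obstacle is that hash values are
  controlled only on key sets of small deficiency. Shrinking a list to such a set destroys its
  surplus of edges, but a suffix in generation order still has at most one vertex more than edges.
  This turns \<open>s + 1\<close> surplus edges into one surplus vertex, a loss of
  \<open>s + 2\<close> factors. Each of the \<open>c\<close> functions \<open>g j\<close> pays
  \<open>l ^ k\<close> for \<open>k\<close> collisions, together about
  \<open>n powr (\<delta> * k * c)\<close>, and \<delta> k c \<ge> s + 2 is the assumption on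
  \<open>c\<close>. The number \<open>2 * k\<close> has one source: \<open>k\<close> collisions
  involve at most \<open>2 * k\<close> keys. Independence of \<open>f\<close> handles the colliding
  keys, independence of \<open>g\<close> the probability of the collisions.\<close>

lemma cyclic_closed_subset:
  assumes "i0 \<in> I" "I \<subseteq> {..<n}" "\<And>i. i \<in> I \<Longrightarrow> Suc i mod n \<in> I"
  shows "I = {..<n}"
proof -
  have step: "(i0 + j) mod n \<in> I" for j
  proof (induction j)
    case 0
    then show ?case using assms(1,2) by auto
  next
    case (Suc j)
    then show ?case using assms(3)[of "(i0 + j) mod n"] by (simp add: mod_Suc_eq)
  qed
  have "t \<in> I" if "t < n" for t
  proof -
    have "i0 < n" using assms by auto
    then have "i0 + (n - i0 + t) = n + t" by simp
    then show ?thesis using step[of "n - i0 + t"] that by simp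
  qed
  then show ?thesis using assms(2) by blast
qed

lemma cycle_ends:
  assumes "length vs = length es" "es \<noteq> []"
    and "\<And>i. i < length es \<Longrightarrow> en (es ! i) = {vs ! i, vs ! (Suc i mod length es)}"
  shows "\<Union> (en ` set es) = set vs"
proof
  show "\<Union> (en ` set es) \<subseteq> set vs"
  proof
    fix v assume "v \<in> \<Union> (en ` set es)"
    then obtain i where i: "i < length es" "v \<in> en (es ! i)"
      by (auto simp: in_set_conv_nth)
    then show "v \<in> set vs" using assms by auto
  qed
  show "set vs \<subseteq> \<Union> (en ` set es)"
  proof
    fix v assume "v \<in> set vs"
    then obtain i where i: "i < length es" "v = vs ! i"
      using assms by (auto simp: in_set_conv_nth)
    then have "v \<in> en (es ! i)" using assms by auto
    then show "v \<in> \<Union> (en ` set es)" using i by auto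
  qed
qed

text \<open>A cycle has as many edges as vertices, so an injective choice of end points exhausts its
  vertices: every vertex of the cycle owns an edge of the cycle.\<close>

lemma cycle_image:
  assumes "is_cycle G C" "inj_on \<phi> (edges G)" "\<And>e. e \<in> edges G \<Longrightarrow> \<phi> e \<in> ends G e"
  shows "\<phi> ` C = \<Union> (ends G ` C)" "C \<noteq> {}" "C \<subseteq> edges G" "\<Union> (ends G ` C) \<noteq> {}"
proof -
  obtain vs es where c: "es \<noteq> []" "length vs = length es" "distinct vs" "distinct es"
     "set vs \<subseteq> verts G" "set es \<subseteq> edges G"
     "\<And>i. i<length es \<Longrightarrow> ends G (es ! i) = {vs ! i, vs ! (Suc i mod length es)}"
     "C = set es" using assms(1) unfolding is_cycle_def by blast
  have u: "\<Union> (ends G ` C) = set vs" using cycle_ends[OF c(2,1,7)] c(8) by simp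
  have sub: "\<phi> ` C \<subseteq> set vs" using u assms(3) c(6,8) by blast
  have "inj_on \<phi> C" using assms(2) c(6,8) inj_on_subset by blast
  then have "card (\<phi> ` C) = card (set vs)"
    using c by (simp add: card_image distinct_card)
  then show "\<phi> ` C = \<Union> (ends G ` C)" using sub u
    by (simp add: card_subset_eq)
  show "C \<noteq> {}" "C \<subseteq> edges G" using c by auto
  show "\<Union> (ends G ` C) \<noteq> {}" using u c by auto
qed

text \<open>The owner map directs a cycle consistently, each edge leading from its owner to the
  other end. A nonempty set closed under these moves therefore contains the whole cycle.\<close>

lemma cycle_no_closed_subset:
  assumes cyc: "is_cycle G C" and inj: "inj_on \<phi> (edges G)"
    and ends: "\<And>e. e \<in> edges G \<Longrightarrow> \<phi> e \<in> ends G e"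
    and A: "A \<noteq> {}" "A \<subseteq> \<Union> (ends G ` C)"
    and closed: "\<And>e. e \<in> C \<Longrightarrow> \<phi> e \<in> A \<Longrightarrow> ends G e \<subseteq> A"
  shows "A = \<Union> (ends G ` C)"
proof -
  obtain vs es where c: "es \<noteq> []" "length vs = length es" "distinct vs" "distinct es"
     "set vs \<subseteq> verts G" "set es \<subseteq> edges G"
     "\<And>i. i<length es \<Longrightarrow> ends G (es ! i) = {vs ! i, vs ! (Suc i mod length es)}"
     "C = set es" using cyc unfolding is_cycle_def by blast
  define n where "n = length es"
  have n0: "n > 0" using c n_def by auto
  have u: "\<Union> (ends G ` C) = set vs" using cycle_ends[OF c(2,1,7)] c(8) by simp
  define I where "I = {i. i < n \<and> vs ! i \<in> A}"
  obtain a where "a \<in> A" using A by auto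
  then have "a \<in> set vs" using A u by auto
  then obtain i0 where i0: "i0 \<in> I" using \<open>a \<in> A\<close> c(2) 
    by (auto simp: in_set_conv_nth I_def n_def)
  have phi: "\<phi> (es ! i) = vs ! i \<or> \<phi> (es ! i) = vs ! (Suc i mod n)" if "i < n" for i
    using ends[of "es ! i"] c(6,7) that n_def by (metis insert_iff nth_mem singletonD subsetD)
  have cl: "\<phi> (es ! i) \<in> A \<Longrightarrow> vs ! i \<in> A \<and> vs ! (Suc i mod n) \<in> A" if "i < n" for i
    using closed[of "es ! i"] c(7,8) that n_def by auto
  have "I = {..<n}"
  proof (cases "\<forall>i<n. \<phi> (es ! i) = vs ! i")
    case True
    show ?thesis
      by (rule cyclic_closed_subset[OF i0]) (use True cl n0 in \<open>auto simp: I_def\<close>)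
  next
    case False
    \<comment> \<open>Positions whose edge is owned by its second end. That vertex is then taken for
      the next edge, so the property spreads round the cycle and holds everywhere.\<close>
    define J where "J = {i. i < n \<and> \<phi> (es ! i) \<noteq> vs ! i}"
    obtain j0 where j0: "j0 \<in> J" using False J_def by auto
    have J: "J = {..<n}"
    proof (rule cyclic_closed_subset[OF j0])
      fix i assume i: "i \<in> J"
      then have "i < n" and 1: "\<phi> (es ! i) = vs ! (Suc i mod n)" and ne: "\<phi> (es ! i) \<noteq> vs ! i"
        using phi by (auto simp: J_def)
      then have "i \<noteq> Suc i mod n" by metis
      then have "es ! i \<noteq> es ! (Suc i mod n)" using c(4) n0 \<open>i < n\<close>
        by (simp add: n_def nth_eq_iff_index_eq)
      then have "\<phi> (es ! i) \<noteq> \<phi> (es ! (Suc i mod n))" 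
        using inj c(6) n0 \<open>i < n\<close> by (metis inj_onD mod_less_divisor n_def nth_mem subsetD)
      then show "Suc i mod n \<in> J" using 1 n0 by (auto simp: J_def)
    qed (auto simp: J_def)
    show ?thesis
    proof (rule ccontr)
      assume "I \<noteq> {..<n}"
      then obtain i1 where i1: "i1 \<in> {..<n} - I" by (auto simp: I_def)
      \<comment> \<open>The edges now point against the index order, so it is the complement of
        \<open>I\<close> that is closed under the successor.\<close>
      have "{..<n} - I = {..<n}"
      proof (rule cyclic_closed_subset[OF i1])
        fix i assume i: "i \<in> {..<n} - I"
        then have "i \<in> J" using J by blast
        then have phi_i: "\<phi> (es ! i) = vs ! (Suc i mod n)" and "i < n" using phi by (auto simp: J_def)
        have "vs ! i \<notin> A" using i \<open>i < n\<close> by (simp add: I_def)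
        then have "vs ! (Suc i mod n) \<notin> A" using cl[OF \<open>i < n\<close>] phi_i by metis
        then show "Suc i mod n \<in> {..<n} - I"
          using n0 by (simp add: I_def)
      qed auto
      then show False using i0 by (auto simp: I_def)
    qed
  qed
  then have "vs ! i \<in> A" if "i < n" for i using that by (auto simp: I_def)
  then have "set vs \<subseteq> A" using c(2) by (metis in_set_conv_nth n_def subsetI)
  then show ?thesis using u A by auto
qed

text \<open>Let \<open>r\<close> move from a vertex to the other end of the edge it owns. This is a
  partial function, and no move leaves a cycle. The vertices \<open>Y\<close> from which
  \<open>C1\<close> is reached are closed under adjacency, hence contain a vertex of
  \<open>C2\<close>. Its orbit stays in \<open>C2\<close> and reaches \<open>C1\<close>, so the
  cycles meet.\<close>

lemma orientation_unique_cycle: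
  assumes inj: "inj_on \<phi> (edges G)" and ends: "\<And>e. e \<in> edges G \<Longrightarrow> \<phi> e \<in> ends G e"
    and K: "K \<in> components G"
    and C1: "C1 \<in> component_cycles G K" and C2: "C2 \<in> component_cycles G K"
  shows "C1 = C2"
proof -
  let ?X1 = "\<Union> (ends G ` C1)" and ?X2 = "\<Union> (ends G ` C2)"
  have cyc: "is_cycle G C1" "is_cycle G C2" and sub: "?X1 \<subseteq> K" "?X2 \<subseteq> K"
    using C1 C2 by (auto simp: component_cycles_def)
  note i1 = cycle_image[OF cyc(1) inj ends] and i2 = cycle_image[OF cyc(2) inj ends]
  define r where "r = {(u, w). \<exists>e\<in>edges G. \<phi> e = u \<and> ends G e = {u, w}}"
  have det: "w = w'" if uw: "(u, w) \<in> r" "(u, w') \<in> r" for u w w'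
  proof -
    obtain e e' where e: "e \<in> edges G" "\<phi> e = u" "ends G e = {u, w}"
      "e' \<in> edges G" "\<phi> e' = u" "ends G e' = {u, w'}"
      using uw unfolding r_def mem_Collect_eq case_prod_conv by blast
    then have "e = e'" using inj by (metis inj_onD)
    then show ?thesis using e by (metis doubleton_eq_iff)
  qed
  have closed: "ends G e \<subseteq> \<Union> (ends G ` C)"
    if "is_cycle G C" "e \<in> edges G" "\<phi> e \<in> \<Union> (ends G ` C)" for C e
  proof -
    have "\<phi> e \<in> \<phi> ` C" "C \<subseteq> edges G" using cycle_image[OF that(1) inj ends] that by auto
    then have "e \<in> C" using inj that(2) by (meson inj_on_image_mem_iff)
    then show ?thesis by auto
  qed
  have rclosed: "w \<in> \<Union> (ends G ` C)" if "is_cycle G C" "(u, w) \<in> r" "u \<in> \<Union> (ends G ` C)" for C u w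
    using that closed[of C] by (fastforce simp: r_def)
  define Y where "Y = {u. \<exists>x\<in>?X1. (u, x) \<in> r\<^sup>*}"
  have Yadj: "b \<in> Y" if ab: "(a, b) \<in> adjacency G" and "a \<in> Y" for a b
  proof -
    obtain e where e: "e \<in> edges G" "ends G e = {a, b}" using ab by (auto simp: adjacency_def)
    obtain x where x: "x \<in> ?X1" "(a, x) \<in> r\<^sup>*" using \<open>a \<in> Y\<close> by (auto simp: Y_def)
    \<comment> \<open>Either \<open>b\<close> moves to \<open>a\<close> along \<open>e\<close>, or
      \<open>b\<close> is the only possible move from \<open>a\<close>, so that the orbit of
      \<open>a\<close> passes through \<open>b\<close> or already lies in the cycle.\<close>
    consider "\<phi> e = b" | "\<phi> e = a" using ends[OF e(1)] e(2) by auto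
    then show ?thesis
    proof cases
      case 1
      then have "(b, a) \<in> r" using e by (auto simp: r_def insert_commute)
      then show ?thesis using x by (auto simp: Y_def intro: converse_rtrancl_into_rtrancl)
    next
      case 2
      then have ab: "(a, b) \<in> r" using e by (auto simp: r_def)
      from x(2) show ?thesis
      proof (cases rule: converse_rtranclE)
        case base
        then have "b \<in> ?X1" using rclosed[OF cyc(1) ab] x by simp
        then show ?thesis by (auto simp: Y_def)
      next
        case (step w)
        then have "w = b" using det ab by blast
        then show ?thesis using step x by (auto simp: Y_def)
      qed
    qed
  qed
  obtain x1 x2 where x: "x1 \<in> ?X1" "x2 \<in> ?X2" using i1(4) i2(4) by blast
  have KK: "(x1, x2) \<in> (adjacency G)\<^sup>*"
  proof -
    define Q where "Q = {(u, v). u \<in> verts G \<and> v \<in> verts G \<and> (u, v) \<in> (adjacency G)\<^sup>*}"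
    have sym: "sym ((adjacency G)\<^sup>*)"
      by (rule sym_rtrancl) (auto simp: sym_def adjacency_def insert_commute)
    have "K \<in> verts G // Q" using K by (simp add: components_def Q_def Sigma_def Collect_case_prod)
    then obtain z where "K = Q `` {z}" by (auto elim: quotientE)
    then have "(z, x1) \<in> (adjacency G)\<^sup>*" "(z, x2) \<in> (adjacency G)\<^sup>*"
      using x sub by (auto simp: Q_def)
    then show ?thesis using sym by (meson rtrancl_trans symD)
  qed
  have "x1 \<in> Y" using x by (auto simp: Y_def)
  with KK have "x2 \<in> Y" by (induction rule: rtrancl_induct) (auto intro: Yadj)
  then obtain x where x': "x \<in> ?X1" "(x2, x) \<in> r\<^sup>*" by (auto simp: Y_def)
  from x'(2) x(2) have "x \<in> ?X2"
    by (induction rule: rtrancl_induct) (auto dest: rclosed[OF cyc(2)])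
  then have ne: "?X1 \<inter> ?X2 \<noteq> {}" using x' by blast
  \<comment> \<open>The common vertices are closed under moves along either cycle, so they are all
    vertices of both. Equal vertex sets mean equal sets of owners, hence equal edge sets.\<close>
  have "?X1 \<inter> ?X2 = ?X1"
    by (rule cycle_no_closed_subset[OF cyc(1) inj ends ne])
       (use i1(3) closed[OF cyc(1)] closed[OF cyc(2)] in blast)+
  moreover have "?X1 \<inter> ?X2 = ?X2"
    by (rule cycle_no_closed_subset[OF cyc(2) inj ends ne])
       (use i2(3) closed[OF cyc(1)] closed[OF cyc(2)] in blast)+
  ultimately have "\<phi> ` C1 = \<phi> ` C2" using i1(1) i2(1) by simp
  then show ?thesis using inj i1(3) i2(3) by (meson inj_on_image_eq_iff)
qed

text \<open>Each edge is owned by one of its ends, that is, directed out of it. Vertices in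
  \<open>V\<close> may not own edges of \<open>D\<close>: they are reserved for edges treated
  before.\<close>

definition orientable :: "('e \<Rightarrow> 'v set) \<Rightarrow> 'e set \<Rightarrow> 'v set \<Rightarrow> bool" where
  "orientable en D V \<longleftrightarrow> (\<exists>\<phi>. inj_on \<phi> D \<and> (\<forall>e\<in>D. \<phi> e \<in> en e - V))"

lemma excess_le_card:
  assumes "R \<subseteq> edges G" "finite R" "orientable (ends G) (edges G - R) {}"
  shows "excess G \<le> card R"
proof -
  let ?G = "remove_edges G R"
  obtain \<phi> where \<phi>: "inj_on \<phi> (edges ?G)" "\<And>e. e \<in> edges ?G \<Longrightarrow> \<phi> e \<in> ends ?G e"
    using assms(3) by (auto simp: orientable_def remove_edges_def)
  have "\<forall>K\<in>components ?G. acyclic_component ?G K \<or> unicyclic_component ?G K"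
    using orientation_unique_cycle[OF \<phi>]
    unfolding acyclic_component_def unicyclic_component_def by blast
  then show ?thesis unfolding excess_def using assms by (intro Least_le) blast
qed

section \<open>Ears\<close>

fun walk :: "('e \<Rightarrow> 'v set) \<Rightarrow> 'v list \<Rightarrow> 'e list \<Rightarrow> bool" where
  "walk en [v] [] \<longleftrightarrow> True"
| "walk en (v # w # vs) (e # es) \<longleftrightarrow> en e = {v, w} \<and> walk en (w # vs) es"
| "walk en _ _ \<longleftrightarrow> False"

lemma walk_append:
  assumes "walk en vs es" "walk en vs' es'" "en e = {last vs, hd vs'}"
  shows "walk en (vs @ vs') (es @ e # es')"
  using assms
proof (induction en vs es rule: walk.induct)
  case (1 en v)
  then show ?case by (cases vs') auto
qed auto

lemma walk_Nil [simp]: "\<not> walk en [] es"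
  by (cases es) auto

lemma walk_length: "walk en vs es \<Longrightarrow> length vs = Suc (length es)"
  by (induction en vs es rule: walk.induct) auto

lemma walk_rev: "walk en vs es \<Longrightarrow> walk en (rev vs) (rev es)"
proof (induction en vs es rule: walk.induct)
  case (2 en v w vs e es)
  then have "walk en (rev (w # vs) @ [v]) (rev es @ e # [])"
    by (intro walk_append) (auto simp: last_rev)
  then show ?case by simp
qed auto

text \<open>An augmenting path for the matching of edges to vertices. Each walk edge is owned by its
  end nearer to \<open>last us\<close>; since \<open>hd us\<close> owns nothing, every edge can be
  handed to its other end, which frees \<open>last us\<close> for \<open>e\<close>.\<close>

lemma orientable_augment:
  assumes "walk en us ws" "map \<phi> ws = tl us" "set ws \<subseteq> D" "distinct us" "set us \<inter> V = {}"
    and "last us \<in> en e" "hd us \<notin> \<phi> ` D" "e \<notin> D"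
    and "inj_on \<phi> D" "\<forall>d\<in>D. \<phi> d \<in> en d - V"
  shows "orientable en (insert e D) V"
  using assms
proof (induction en us ws arbitrary: \<phi> rule: walk.induct)
  case (1 en v)
  then have "inj_on (\<phi>(e := v)) (insert e D) \<and> (\<forall>d\<in>insert e D. (\<phi>(e := v)) d \<in> en d - V)"
    by (auto simp: inj_on_def)
  then show ?case unfolding orientable_def by blast
next
  case (2 en v w vs d es)
  define \<psi> where "\<psi> = \<phi>(d := v)"
  have d: "d \<in> D" "\<phi> d = w" "en d = {v, w}" "d \<notin> set es" using 2 by auto
  have [simp]: "map \<psi> es = map \<phi> es" using d by (auto simp: \<psi>_def)
  show ?case
  proof (rule "2.IH"[of \<psi>])
    show "inj_on \<psi> D" using 2(8,10) by (auto simp: inj_on_def \<psi>_def)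
    show "\<forall>d\<in>D. \<psi> d \<in> en d - V" using 2(6,11) d by (auto simp: \<psi>_def)
    show "hd (w # vs) \<notin> \<psi> ` D"
      using 2(5,10) d by (auto simp: \<psi>_def inj_on_def)
  qed (use 2 in auto)
qed auto

text \<open>Among the walks that leave \<open>a\<close> along owned edges and avoid
  \<open>X\<close>, a longest one is taken; \<open>us\<close> lists it from its tip back to
  \<open>a\<close>. Its tip owns an edge \<open>y\<close>, for otherwise augmenting would orient
  \<open>e\<close>, and by maximality \<open>y\<close> ends in \<open>X\<close> or on the walk.
  \<open>X\<close> may exceed \<open>V\<close>, so that a second path can be kept off a first
  one.\<close>

lemma closing_path:
  assumes fin: "finite D" and en: "\<And>d. d \<in> D \<Longrightarrow> \<exists>a b. en d = {a, b}"
    and inj: "inj_on \<phi> D" and \<phi>: "\<forall>d\<in>D. \<phi> d \<in> en d - V" and e: "e \<notin> D"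
    and non: "\<not> orientable en (insert e D) V" and a: "a \<in> en e" "a \<notin> X" and X: "V \<subseteq> X"
  obtains us ws y where "walk en us ws" "last us = a" "distinct us" "set us \<inter> X = {}"
    "distinct (y # ws)" "set (y # ws) \<subseteq> D" "\<phi> ` set (y # ws) \<subseteq> set us" "en y \<subseteq> X \<union> set us"
proof -
  define P where "P = (\<lambda>(us, ws). walk en us ws \<and> last us = a \<and> distinct us \<and> set us \<inter> X = {} \<and>
     set ws \<subseteq> D \<and> map \<phi> ws = tl us)"
  have P0: "P ([a], [])" using a by (auto simp: P_def)
  have bd: "length (fst p) < card D + 2" if "P p" for p
  proof -
    obtain us ws where p: "p = (us, ws)" by (cases p)
    have "distinct (map \<phi> ws)" using that by (auto simp: P_def p distinct_tl)
    then have "distinct ws" by (simp add: distinct_map)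
    then have "length ws \<le> card D" using that fin
      by (metis (no_types, lifting) P_def case_prodD card_mono distinct_card p)
    moreover have "length us = Suc (length ws)" using that by (auto simp: P_def p intro: walk_length)
    ultimately show ?thesis by (simp add: p)
  qed
  obtain p where p: "P p" and max: "\<And>q. P q \<Longrightarrow> length (fst q) \<le> length (fst p)"
    using ex_has_greatest_nat[of P "([a],[])" "\<lambda>p. length (fst p)" "card D + 2"] P0 bd by metis
  obtain us ws where pp: "p = (us, ws)" by (cases p)
  have W: "walk en us ws" "last us = a" "distinct us" "set us \<inter> X = {}" "set ws \<subseteq> D" "map \<phi> ws = tl us"
    using p by (auto simp: P_def pp)
  obtain u us' where us: "us = u # us'" using W(1) by (cases us) auto
  have "hd us \<in> \<phi> ` D"
  proof (rule ccontr)
    assume "hd us \<notin> \<phi> ` D"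
    then have "orientable en (insert e D) V"
      using orientable_augment[OF W(1,6,5,3) _ _ _ e inj \<phi>] W(2,4) a X by blast
    then show False using non by simp
  qed
  then obtain y where y: "y \<in> D" "\<phi> y = u" using us by auto
  obtain w where w: "en y = {u, w}" using en[OF y(1)] \<phi> y
    by (metis Diff_iff insert_commute insert_iff singletonD)
  have img: "\<phi> ` set ws = set us'" using W(6) us by (metis list.sel(3) set_map)
  then have "y \<notin> set ws" using y W(3) us by auto
  have "distinct (map \<phi> ws)" using W us by simp
  then have "distinct ws" by (simp add: distinct_map)
  have "w \<in> X \<union> set us"
  proof (rule ccontr)
    assume "w \<notin> X \<union> set us"
    then have "P (w # us, y # ws)"
      using W w y us by (auto simp: P_def)
    then show False using max pp by fastforce
  qed
  then show ?thesis
    using that[of us ws y] W w y us img \<open>y \<notin> set ws\<close> \<open>distinct ws\<close> by auto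
qed

text \<open>
  Take a minimal non-orientable subset, remove an edge \<open>e\<close> and orient the rest. From both ends of
  \<open>e\<close> follow the orientation: the walk cannot stop at a vertex that owns no edge, since reversing
  the walk would free an end of \<open>e\<close>, so it closes up on \<open>V\<close> or on the path itself.
\<close>

lemma ear_exists:
  assumes "finite D" and "\<And>d. d \<in> D \<Longrightarrow> \<exists>a b. en d = {a, b}" and "\<not> orientable en D V"
  obtains vs es ys e where "vs = [] \<and> es = [] \<and> length ys = 1 \<or> walk en vs es \<and> length ys = 2"
    "distinct vs" "set vs \<inter> V = {}" "distinct (ys @ es)" "set (ys @ es) \<subseteq> D"
    "\<And>y. y \<in> set ys \<Longrightarrow> en y \<subseteq> V \<union> set vs"
    "e \<in> set (ys @ es)" "orientable en (set (ys @ es) - {e}) V"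
proof -
  define Q where "Q = (\<lambda>D'. D' \<subseteq> D \<and> \<not> orientable en D' V)"
  obtain D' where D': "Q D'" and min: "\<And>D''. Q D'' \<Longrightarrow> card D' \<le> card D''"
    using ex_has_least_nat[of Q D card] assms(3) by (auto simp: Q_def)
  have fin: "finite D'" using D' assms(1) by (auto simp: Q_def intro: finite_subset)
  have "D' \<noteq> {}" using D' by (auto simp: Q_def orientable_def)
  then obtain e where e: "e \<in> D'" by blast
  define D0 where "D0 = D' - {e}"
  have D0: "finite D0" "e \<notin> D0" "insert e D0 = D'" "D0 \<subseteq> D"
    using fin e D' by (auto simp: D0_def Q_def)
  have "\<not> Q D0" using min[of D0] fin e D0_def by (metis card_Diff1_less leD)
  then have "orientable en D0 V" using D0 by (auto simp: Q_def)
  then obtain \<phi> where \<phi>: "inj_on \<phi> D0" "\<forall>d\<in>D0. \<phi> d \<in> en d - V"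
    by (auto simp: orientable_def)
  have ori: "orientable en A V" if "A \<subseteq> D0" for A
    using \<phi> that unfolding orientable_def by (metis inj_on_subset subsetD)
  have non: "\<not> orientable en (insert e D0) V" using D' D0 by (auto simp: Q_def)
  have eD: "e \<in> D" using e D' by (auto simp: Q_def)
  obtain a b where ab: "en e = {a, b}" and or: "a \<notin> V \<or> {a, b} \<subseteq> V"
    using assms(2)[OF eD] by (metis empty_subsetI insert_commute insert_subset)
  note cp = closing_path[OF D0(1) _ \<phi> D0(2) non]
  show thesis
  proof (cases "{a, b} \<subseteq> V")
    case True
    then show thesis using that[of "[]" "[]" "[e]" e] eD ab ori[of "{}"] by auto
  next
    case False
    then have "a \<notin> V" using or by blast
    obtain us ws y where A: "walk en us ws" "last us = a" "distinct us" "set us \<inter> V = {}"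
    "distinct (y # ws)" "set (y # ws) \<subseteq> D0" "\<phi> ` set (y # ws) \<subseteq> set us" "en y \<subseteq> V \<union> set us"
      using cp[of a V] assms(2) D0(4) ab \<open>a \<notin> V\<close> by blast
    have aus: "a \<in> set us" using A(1,2) by (metis last_in_set walk_Nil)
    show thesis
    proof (cases "b \<in> V \<union> set us")
      case True
      \<comment> \<open>Both ends of \<open>e\<close> are already known vertices, so
        \<open>e\<close> itself is the second closing edge.\<close>
      show thesis
        by (rule that[of us ws "[y, e]" e])
          (use True A aus ab eD D0 in \<open>auto intro!: ori\<close>)
    next
      case False
      obtain us' ws' y' where B: "walk en us' ws'" "last us' = b" "distinct us'"
        "set us' \<inter> (V \<union> set us) = {}" "distinct (y' # ws')" "set (y' # ws') \<subseteq> D0"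
        "\<phi> ` set (y' # ws') \<subseteq> set us'" "en y' \<subseteq> (V \<union> set us) \<union> set us'"
        using cp[of b "V \<union> set us"] assms(2) D0(4) ab False by blast
      have disj: "set (y # ws) \<inter> set (y' # ws') = {}"
        using A(7) B(4,7) by blast
      have "us' \<noteq> []" using B(1) by auto
      then have "hd (rev us') = b" using B(2) by (simp add: hd_rev)
      then have W: "walk en (us @ rev us') (ws @ e # rev ws')"
        using walk_append[OF A(1) walk_rev[OF B(1)], of e] A(2) ab by simp
      show thesis
      proof (rule that[of "us @ rev us'" "ws @ e # rev ws'" "[y, y']" e])
        show "distinct ([y, y'] @ ws @ e # rev ws')"
          using A(5,6) B(5,6) disj D0(2) by auto
        show "orientable en (set ([y, y'] @ ws @ e # rev ws') - {e}) V"
          using A(6) B(6) by (intro ori) auto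
      qed (use W A B eD D0 in auto)
    qed
  qed
qed

text \<open>Edges of \<open>A\<close> own vertices inside \<open>V\<close>, edges of
  \<open>B\<close> vertices outside, so the two owner maps cannot clash.\<close>

lemma orientable_Un:
  assumes "orientable en A {}" "\<And>e. e \<in> A \<Longrightarrow> en e \<subseteq> V" "orientable en B V" "A \<inter> B = {}"
  shows "orientable en (A \<union> B) {}"
proof -
  obtain \<phi> \<psi> where *: "inj_on \<phi> A" "\<forall>e\<in>A. \<phi> e \<in> en e" "inj_on \<psi> B" "\<forall>e\<in>B. \<psi> e \<in> en e - V"
    using assms unfolding orientable_def by auto
  define \<theta> where "\<theta> x = (if x \<in> A then \<phi> x else \<psi> x)" for x
  have "inj_on \<theta> (A \<union> B)"
  proof (rule inj_onI)
    fix x y assume "x \<in> A \<union> B" "y \<in> A \<union> B" "\<theta> x = \<theta> y"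
    moreover have "\<phi> u \<noteq> \<psi> v" if "u \<in> A" "v \<in> B" for u v
    proof -
      have "\<phi> u \<in> V" "\<psi> v \<notin> V" using *(2,4) assms(2)[OF that(1)] that by auto
      then show ?thesis by metis
    qed
    ultimately show "x = y" using *(1,3) inj_onD[of \<phi> A x y] inj_onD[of \<psi> B x y]
      by (cases "x \<in> A"; cases "y \<in> A") (simp_all add: \<theta>_def, metis)
  qed
  moreover have "\<forall>e\<in>A \<union> B. \<theta> e \<in> en e" using * by (auto simp: \<theta>_def)
  ultimately show ?thesis unfolding orientable_def by auto
qed

section \<open>Counting edge lists generated by ears\<close>

text \<open>
  \<open>build m q es us\<close>: the edges \<open>es\<close> (newest first) are generated from an empty graph, \<open>us\<close> being the
  vertices introduced so far. Ordinary steps extend a path at its current end \<open>hd us\<close> and cost only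
  the choice of one label below \<open>m\<close>; \<open>q\<close> counts the remaining moves, which start a path or add an
  edge between known vertices. No distinctness is required, as only upper bounds on the number
  of such \<open>es\<close> matter.
\<close>

inductive build :: "nat \<Rightarrow> nat \<Rightarrow> (nat \<times> nat) list \<Rightarrow> (nat + nat) list \<Rightarrow> bool" for m where
  empty: "build m 0 [] []"
| vertex: "build m q es us \<Longrightarrow> length us \<le> length es \<Longrightarrow> u \<in> Inl ` {..<m} \<union> Inr ` {..<m} \<Longrightarrow>
    build m (Suc q) es (u # us)"
| step: "build m q es (u # us) \<Longrightarrow> a < m \<Longrightarrow> b < m \<Longrightarrow> {Inl a, Inr b} = {u, w} \<Longrightarrow>
    build m q ((a, b) # es) (w # u # us)"
| close: "build m q es us \<Longrightarrow> Inl a \<in> set us \<Longrightarrow> Inr b \<in> set us \<Longrightarrow>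
    build m (Suc q) ((a, b) # es) us"

text \<open>The guard \<open>length us \<le> length es\<close> of the rule \<open>vertex\<close>
  serves this bound: a path may be started only if the vertices do not yet outnumber the
  edges.\<close>

lemma build_length: "build m q es us \<Longrightarrow> length us \<le> Suc (length es)"
  by (induction rule: build.induct) auto

text \<open>Undoing the latest moves until \<open>j\<close> edges are gone leaves a shorter
  generation. Together with \<open>build_length\<close> this bounds the vertices spanned by every
  suffix.\<close>

lemma build_drop:
  assumes "build m q es us"
  shows "\<exists>q'\<le>q. \<exists>us'. build m q' (drop j es) us'"
  using assms
proof (induction arbitrary: j rule: build.induct)
  case empty
  then show ?case by (auto intro: build.empty)
next
  case (vertex q es us u)
  then show ?case by (meson le_SucI)
next
  case (step q es u us a b w)
  show ?case
  proof (cases j)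
    case 0
    then show ?thesis using build.step[OF step.hyps] by auto
  next
    case (Suc j')
    then show ?thesis using step.IH[of j'] by simp
  qed
next
  case (close q es us a b)
  show ?case
  proof (cases j)
    case 0
    then show ?thesis using build.close[OF close.hyps] by auto
  next
    case (Suc j')
    then show ?thesis using close.IH[of j'] by (auto intro: le_SucI)
  qed
qed

lemma build_0: "build m q es us \<Longrightarrow> q = 0 \<Longrightarrow> es = [] \<and> us = []"
  by (induction rule: build.induct) auto

definition builds :: "nat \<Rightarrow> nat \<Rightarrow> nat \<Rightarrow> nat \<Rightarrow> ((nat \<times> nat) list \<times> (nat + nat) list) set" where
  "builds m q t v = {(es, us). build m q es us \<and> length es = t \<and> length us = v}"

text \<open>Classification by the last move. A \<open>step\<close> needs one label because the other
  is read off \<open>hd us\<close>, and a closing edge needs two positions in \<open>us\<close>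
  instead of two labels. The vertex list is counted along with the edges because it steers this
  decoding.\<close>

lemma builds_subset:
  "builds m (Suc q) t v \<subseteq>
     (if v = 0 then {} else
        (\<lambda>((es, us), u). (es, u # us)) ` (builds m q t (v - 1) \<times> (Inl ` {..<m} \<union> Inr ` {..<m}))) \<union>
     (if v = 0 \<or> t = 0 then {} else
        (\<lambda>((es, us), w). case hd us of
            Inl a \<Rightarrow> ((a, w) # es, Inr w # us) | Inr b \<Rightarrow> ((w, b) # es, Inl w # us)) `
          (builds m (Suc q) (t - 1) (v - 1) \<times> {..<m})) \<union>
     (if t = 0 then {} else
        (\<lambda>((es, us), i, j). ((projl (us ! i), projr (us ! j)) # es, us)) `
          (builds m q (t - 1) v \<times> {..<v} \<times> {..<v}))"
  (is "_ \<subseteq> ?I \<union> ?S \<union> ?C")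
proof
  fix p assume "p \<in> builds m (Suc q) t v"
  then obtain es us where p: "p = (es, us)" "build m (Suc q) es us" "length es = t" "length us = v"
    by (auto simp: builds_def)
  let ?f = "\<lambda>((es, us), u). (es, u # us) :: (nat \<times> nat) list \<times> (nat + nat) list"
  let ?g = "\<lambda>((es, us), w). case hd us of
      Inl a \<Rightarrow> ((a, w) # es, Inr w # us) | Inr b \<Rightarrow> ((w, b) # es, Inl w # us)"
  let ?h = "\<lambda>((es, us), i, j). ((projl (us ! i), projr (us ! j)) # es, us)"
  from p(2) show "p \<in> ?I \<union> ?S \<union> ?C"
  proof (cases rule: build.cases)
    case (vertex us' u)
    then have "((es, us'), u) \<in> builds m q t (v - 1) \<times> (Inl ` {..<m} \<union> Inr ` {..<m})"
      using p by (auto simp: builds_def)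
    then have "p \<in> ?f ` (builds m q t (v - 1) \<times> (Inl ` {..<m} \<union> Inr ` {..<m}))"
      by (rule image_eqI[rotated]) (simp add: vertex p)
    then show ?thesis using vertex p by auto
  next
    case (step es' u us' a b w)
    then have b: "(es', u # us') \<in> builds m (Suc q) (t - 1) (v - 1)"
      using p by (auto simp: builds_def)
    have "v \<noteq> 0" "t \<noteq> 0" using step p by auto
    have "u = Inl a \<and> w = Inr b \<or> u = Inr b \<and> w = Inl a"
      using step(6) by (auto simp: doubleton_eq_iff)
    then have "p \<in> ?g ` (builds m (Suc q) (t - 1) (v - 1) \<times> {..<m})"
    proof
      assume "u = Inl a \<and> w = Inr b"
      then show ?thesis using b step p(1)
        by (intro image_eqI[of _ _ "((es', u # us'), b)"]) simp_all
    next
      assume "u = Inr b \<and> w = Inl a"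
      then show ?thesis using b step p(1)
        by (intro image_eqI[of _ _ "((es', u # us'), a)"]) simp_all
    qed
    then show ?thesis using \<open>v \<noteq> 0\<close> \<open>t \<noteq> 0\<close> by simp
  next
    case (close es' a b)
    then have b: "(es', us) \<in> builds m q (t - 1) v"
      using p by (auto simp: builds_def)
    obtain i j where "i < v" "us ! i = Inl a" "j < v" "us ! j = Inr b"
      using close p by (metis in_set_conv_nth)
    then have "p \<in> ?h ` (builds m q (t - 1) v \<times> {..<v} \<times> {..<v})" using b close(1) p(1)
      by (intro image_eqI[of _ _ "((es', us), i, j)"]) simp_all
    moreover have "t \<noteq> 0" using close p by auto
    ultimately show ?thesis by simp
  qed
qed

lemma card_image_prod_le:
  assumes "finite A" "finite B" "card A \<le> a" "card B \<le> b"
  shows "finite (f ` (A \<times> B)) \<and> card (f ` (A \<times> B)) \<le> a * b"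
  using assms card_image_le[of "A \<times> B" f] mult_le_mono[of "card A" a "card B" b]
  by (simp add: card_cartesian_product)

text \<open>An induction on \<open>t\<close> is nested in one on \<open>q\<close>, since a
  \<open>step\<close> keeps \<open>q\<close>. Let \<open>P = 2 + T\<^sup>2\<close>. For length
  \<open>t + 1\<close> the last move contributes, relative to a common factor, \<open>2\<close> for
  a vertex on either side, \<open>(t + 1) * P\<close> for a step and \<open>T\<^sup>2\<close> for
  two positions; the sum is \<open>(t + 2) * P\<close>. The fixed bound \<open>T\<close> keeps
  \<open>P\<close> constant during the induction.\<close>

lemma card_builds:
  assumes "t \<le> T"
  shows "finite (builds m q t v) \<and> card (builds m q t v) \<le> ((t + 1) * (2 + T\<^sup>2)) ^ q * m ^ v"
  using assms
proof (induction q arbitrary: t v)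
  case 0
  have "builds m 0 t v \<subseteq> (if v = 0 then {([], [])} else {})"
    by (auto simp: builds_def dest: build_0)
  then show ?case
    by (cases "v = 0") (auto dest: finite_subset card_mono[rotated])
next
  case (Suc q)
  define P where "P = 2 + T\<^sup>2"
  from Suc.prems show ?case
  proof (induction t arbitrary: v)
    case 0
    have card2: "card (Inl ` {..<m} \<union> Inr ` {..<m} :: (nat + nat) set) \<le> 2 * m"
      by (rule order_trans[OF card_Un_le]) (simp add: card_image)
    show ?case
    proof (cases "v = 0")
      case True
      then have "builds m (Suc q) 0 v = {}" using builds_subset[of m q 0 v] by simp
      then show ?thesis by simp
    next
      case False
      let ?I = "(\<lambda>((es, us), u). (es, u # us)) ` (builds m q 0 (v - 1) \<times> (Inl ` {..<m} \<union> Inr ` {..<m}))"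
      have "builds m (Suc q) 0 v \<subseteq> ?I"
        using builds_subset[of m q 0 v] False by simp
      moreover have "finite ?I \<and> card ?I \<le> (P ^ q * m ^ (v - 1)) * (2 * m)"
        using Suc.IH[of 0 "v - 1"] card2 by (intro card_image_prod_le) (auto simp: P_def)
      ultimately have "finite (builds m (Suc q) 0 v)"
        "card (builds m (Suc q) 0 v) \<le> (P ^ q * m ^ (v - 1)) * (2 * m)"
        by (meson card_mono finite_subset order_trans)+
      moreover have "(P ^ q * m ^ (v - 1)) * (2 * m) = 2 * P ^ q * m ^ v"
        using False by (cases v) auto
      moreover have "\<dots> \<le> P ^ Suc q * m ^ v"
        by (simp add: P_def)
      ultimately have "card (builds m (Suc q) 0 v) \<le> P ^ Suc q * m ^ v" by linarith
      then show ?thesis using \<open>finite (builds m (Suc q) 0 v)\<close> by (simp add: P_def)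
    qed
  next
    case (Suc t)
    note IHq = \<open>\<And>t v. t \<le> T \<Longrightarrow> finite (builds m q t v) \<and> card (builds m q t v) \<le> ((t + 1) * (2 + T\<^sup>2)) ^ q * m ^ v\<close>
    have card2: "card (Inl ` {..<m} \<union> Inr ` {..<m} :: (nat + nat) set) \<le> 2 * m"
      by (rule order_trans[OF card_Un_le]) (simp add: card_image)
    define X where "X = (t + 2) * P"
    define I where "I = (if v = 0 then {} else
        (\<lambda>((es, us), u). (es, u # us)) ` (builds m q (Suc t) (v - 1) \<times> (Inl ` {..<m} \<union> Inr ` {..<m})))"
    define S where "S = (if v = 0 then {} else
        (\<lambda>((es, us), w). case hd us of
            Inl a \<Rightarrow> ((a, w) # es, Inr w # us) | Inr b \<Rightarrow> ((w, b) # es, Inl w # us)) `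
          (builds m (Suc q) t (v - 1) \<times> {..<m}))"
    define C where "C = (\<lambda>((es, us), i, j). ((projl (us ! i), projr (us ! j)) # es, us)) `
          (builds m q t v \<times> {..<v} \<times> {..<v})"
    have sub: "builds m (Suc q) (Suc t) v \<subseteq> I \<union> S \<union> C"
      using builds_subset[of m q "Suc t" v] by (auto simp: I_def S_def C_def split: if_splits)
    have tX: "(t + 1) * P \<le> X" by (simp add: X_def)
    have Xeq: "(Suc t + 1) * (2 + T\<^sup>2) = X" by (simp add: X_def P_def)
    have tT: "t \<le> T" using Suc.prems by simp
    note IHX = IHq[OF Suc.prems, unfolded Xeq] and IHt = IHq[OF tT, folded P_def]
      and IHS = Suc.IH[OF tT, folded P_def]
    have I: "finite I \<and> card I \<le> X ^ q * m ^ v * 2"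
    proof (cases v)
      case (Suc v')
      have "finite I \<and> card I \<le> (X ^ q * m ^ v') * (2 * m)"
        unfolding I_def using IHX[of v'] card2
        by (simp only: Suc nat.distinct if_False diff_Suc_1) (intro card_image_prod_le, simp_all)
      then show ?thesis by (simp add: Suc mult_ac)
    qed (simp add: I_def)
    have S: "finite S \<and> card S \<le> X ^ q * m ^ v * ((t + 1) * P)"
    proof (cases v)
      case (Suc v')
      have "finite S \<and> card S \<le> (((t + 1) * P) ^ Suc q * m ^ v') * m"
        unfolding S_def using IHS[of v']
        by (simp only: Suc nat.distinct if_False diff_Suc_1) (intro card_image_prod_le, simp_all only: card_lessThan finite_lessThan)
      moreover have "(((t + 1) * P) ^ Suc q * m ^ v') * m \<le> X ^ q * m ^ v * ((t + 1) * P)"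
        using power_mono[OF tX, of q] by (simp add: Suc mult_ac)
      ultimately show ?thesis by linarith
    qed (simp add: S_def)
    have C: "finite C \<and> card C \<le> X ^ q * m ^ v * T\<^sup>2"
    proof (cases "builds m q t v = {}")
      case False
      \<comment> \<open>The vertex bound also limits the number of position pairs for a closing
        edge.\<close>
      then have "v \<le> Suc t" using build_length by (fastforce simp: builds_def)
      then have "v \<le> T" using Suc.prems by linarith
      then have "v * v \<le> T\<^sup>2" by (simp add: power2_eq_square mult_le_mono)
      then have "finite C \<and> card C \<le> (((t + 1) * P) ^ q * m ^ v) * T\<^sup>2"
        unfolding C_def using IHt[of v]
        by (intro card_image_prod_le) (simp_all only: card_cartesian_product card_lessThan finite_lessThan finite_cartesian_product)
      moreover have "(((t + 1) * P) ^ q * m ^ v) * T\<^sup>2 \<le> X ^ q * m ^ v * T\<^sup>2"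
        using power_mono[OF tX, of q] by simp
      ultimately show ?thesis by linarith
    qed (simp add: C_def)
    have fin: "finite (I \<union> S \<union> C)" using I S C by simp
    have "card (builds m (Suc q) (Suc t) v) \<le> card (I \<union> S \<union> C)"
      using sub fin by (rule card_mono[rotated])
    also have "\<dots> \<le> card I + card S + card C"
      by (meson card_Un_le add_le_mono1 order_trans)
    also have "\<dots> \<le> X ^ q * m ^ v * 2 + X ^ q * m ^ v * ((t + 1) * P) + X ^ q * m ^ v * T\<^sup>2"
      using I S C by linarith
    also have "\<dots> = X ^ q * m ^ v * X"
      by (simp add: X_def P_def algebra_simps)
    finally have "card (builds m (Suc q) (Suc t) v) \<le> X ^ Suc q * m ^ v"
      by (simp add: mult_ac)
    then show ?case unfolding Xeq using finite_subset[OF sub fin] by blast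
  qed
qed

section \<open>From large excess to a generated edge list\<close>

context
  fixes m :: nat and h1 h2 :: "'a \<Rightarrow> nat"
begin

abbreviation key_edge :: "'a \<Rightarrow> nat \<times> nat" where
  "key_edge \<equiv> \<lambda>x. (h1 x, h2 x)"

abbreviation key_ends :: "'a \<Rightarrow> (nat + nat) set" where
  "key_ends \<equiv> \<lambda>x. {Inl (h1 x), Inr (h2 x)}"

lemma build_walk:
  assumes "build m q (map key_edge xs) (v # us)" "walk key_ends (v # vs) es"
    and "\<And>e. e \<in> set es \<Longrightarrow> h1 e < m \<and> h2 e < m"
  shows "build m q (map key_edge (rev es @ xs)) (rev vs @ v # us)"
  using assms
proof (induction vs arbitrary: v es us xs)
  case Nil
  then show ?case by (cases es) auto
next
  case (Cons w vs)
  then obtain e es' where es: "es = e # es'" by (cases es) auto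
  have "build m q (key_edge e # map key_edge xs) (w # v # us)"
    using Cons.prems es by (intro build.step) auto
  then have "build m q (map key_edge (rev es' @ e # xs)) (rev vs @ w # v # us)"
    using Cons.prems es by (intro Cons.IH) auto
  then show ?case by (simp add: es)
qed

text \<open>
  \<open>R\<close> contains one edge of each ear. If there were no further ear, the remaining keys could be
  oriented away from the vertices used so far, and removing \<open>R\<close> would leave an orientable graph.
\<close>

lemma build_ears:
  assumes S: "finite S" "h1 \<in> S \<rightarrow> {..<m}" "h2 \<in> S \<rightarrow> {..<m}"
    and ex: "excess (cuckoo_graph m S h1 h2) \<ge> s + 1" and "i \<le> s + 1"
  shows "\<exists>xs q us R. distinct xs \<and> set xs \<subseteq> S \<and> build m q (map key_edge xs) us \<and>
     length us + i = length xs \<and> q \<le> 3 * i \<and> (\<forall>x\<in>set xs. key_ends x \<subseteq> set us) \<and>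
     R \<subseteq> set xs \<and> card R \<le> i \<and> orientable key_ends (set xs - R) {}"
  using \<open>i \<le> s + 1\<close>
proof (induction i)
  case 0
  then show ?case
    by (intro exI[of _ "[]"] exI[of _ 0] exI[of _ "{}"]) (auto intro: build.empty simp: orientable_def)
next
  case (Suc i)
  then obtain xs q us R where IH: "distinct xs" "set xs \<subseteq> S" "build m q (map key_edge xs) us"
     "length us + i = length xs" "q \<le> 3 * i" "\<And>x. x\<in>set xs \<Longrightarrow> key_ends x \<subseteq> set us"
     "R \<subseteq> set xs" "card R \<le> i" "orientable key_ends (set xs - R) {}"
    by auto
  have finR: "finite R" using IH(7) finite_subset by blast
  have non: "\<not> orientable key_ends (S - set xs) (set us)"
  proof
    assume o: "orientable key_ends (S - set xs) (set us)"
    have "orientable key_ends ((set xs - R) \<union> (S - set xs)) {}"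
      by (rule orientable_Un[OF IH(9) _ o]) (use IH(6) in auto)
    moreover have "(set xs - R) \<union> (S - set xs) = S - R" using IH by auto
    ultimately have "excess (cuckoo_graph m S h1 h2) \<le> card R"
      using IH finR by (intro excess_le_card) (auto simp: cuckoo_graph_def)
    then show False using ex IH(8) Suc.prems by simp
  qed
  have fin: "finite (S - set xs)" and two: "\<exists>a b. key_ends d = {a, b}" for d
    using S(1) by blast+
  obtain vs es ys e where ear:
    "vs = [] \<and> es = [] \<and> length ys = 1 \<or> walk key_ends vs es \<and> length ys = 2"
    "distinct vs" "set vs \<inter> set us = {}" "distinct (ys @ es)" "set (ys @ es) \<subseteq> S - set xs"
    "\<And>y. y \<in> set ys \<Longrightarrow> key_ends y \<subseteq> set us \<union> set vs"
    "e \<in> set (ys @ es)" "orientable key_ends (set (ys @ es) - {e}) (set us)"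
    by (rule ear_exists[OF fin two non]) (rule that)
  let ?xs = "ys @ rev es @ xs" and ?us = "rev vs @ us"
  have range: "h1 x < m" "h2 x < m" if "x \<in> S" for x using S that by auto
  have wends: "key_ends x \<subseteq> set vs'" if "walk key_ends vs' es'" "x \<in> set es'" for vs' es' x
    using that by (induction key_ends vs' es' rule: walk.induct) auto
  \<comment> \<open>An ear takes at most three moves: one starts the path and two close it.\<close>
  have B: "\<exists>q'\<le>3 * Suc i. build m q' (map key_edge ?xs) ?us"
    using ear(1)
  proof
    assume "vs = [] \<and> es = [] \<and> length ys = 1"
    then obtain y where y: "vs = []" "es = []" "ys = [y]" by (auto simp: length_Suc_conv)
    have "build m (Suc q) (key_edge y # map key_edge xs) us"
      using ear(6)[of y] y by (intro build.close IH) auto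
    then show ?thesis using IH(5) y by (intro exI[of _ "Suc q"]) auto
  next
    assume *: "walk key_ends vs es \<and> length ys = 2"
    then obtain y y' where y: "ys = [y, y']" by (auto simp: length_Suc_conv numeral_2_eq_2)
    obtain v vs' where vs: "vs = v # vs'" using * by (cases vs) auto
    have "v \<in> Inl ` {..<m} \<union> Inr ` {..<m}"
    proof (cases vs')
      case Nil
      then have "es = []" using * vs by (cases es) auto
      \<comment> \<open>With a single new vertex and no path edge, one closing edge remains after
        removing \<open>e\<close>. Orientability makes it own a vertex that was unknown before,
        which can only be \<open>v\<close>.\<close>
      have "v \<in> (\<Union>d\<in>S. key_ends d)"
      proof -
        have "set (ys @ es) - {e} \<noteq> {}" using y ear(4) by auto
        then obtain d where d: "d \<in> set (ys @ es)" "d \<noteq> e" by auto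
        then obtain z where z: "z \<in> key_ends d - set us" 
          using ear(8) by (auto simp: orientable_def)
        have "d \<in> set ys" using d \<open>es = []\<close> by auto
        then have "z \<in> set vs" using z ear(6)[of d] by auto
        then have "z = v" using vs Nil by simp
        then show ?thesis using z d ear(5) by auto
      qed
      then show ?thesis using range by auto
    next
      case (Cons w vs'')
      then obtain d es' where "es = d # es'" using * vs by (cases es) auto
      then have "v \<in> key_ends d" "d \<in> S" using * vs Cons ear(5) by auto
      then show ?thesis using range by auto
    qed
    \<comment> \<open>The guard of \<open>vertex\<close> holds because the edges so far exceed the
      vertices by \<open>i\<close>.\<close>
    then have "build m (Suc q) (map key_edge xs) (v # us)"
      using IH(4) by (intro build.vertex IH) auto
    then have "build m (Suc q) (map key_edge (rev es @ xs)) (rev vs' @ v # us)"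
      using * vs ear(5) range by (intro build_walk) auto
    then have "build m (Suc (Suc (Suc q))) (key_edge y # key_edge y' # map key_edge (rev es @ xs)) (rev vs' @ v # us)"
      using ear(6)[of y] ear(6)[of y'] y vs by (intro build.close) auto
    then show ?thesis using IH(5) y vs by (intro exI[of _ "Suc (Suc (Suc q))"]) auto
  qed
  then obtain q' where q': "q' \<le> 3 * Suc i" "build m q' (map key_edge ?xs) ?us" by blast
  \<comment> \<open>Both kinds of ear have exactly one edge more than new vertices.\<close>
  have len: "length ?us + Suc i = length ?xs"
    using ear(1) IH(4) by (auto dest: walk_length)
  have ends: "\<forall>x\<in>set ?xs. key_ends x \<subseteq> set ?us"
  proof
    fix x assume "x \<in> set ?xs"
    then consider "x \<in> set ys" | "x \<in> set es" | "x \<in> set xs" by auto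
    then show "key_ends x \<subseteq> set ?us"
    proof cases
      case 2
      then have "walk key_ends vs es" using ear(1) by auto
      then show ?thesis using wends[OF _ 2] by auto
    qed (use ear(6) IH(6) in \<open>auto\<close>)
  qed
  have "orientable key_ends ((set xs - R) \<union> (set (ys @ es) - {e})) {}"
    by (rule orientable_Un[OF IH(9) _ ear(8)]) (use IH(6) ear(5) in auto)
  moreover have "(set xs - R) \<union> (set (ys @ es) - {e}) = set ?xs - insert e R"
    using ear(5,7) IH(7) by auto
  ultimately have o: "orientable key_ends (set ?xs - insert e R) {}" by simp
  have "card (insert e R) \<le> Suc i" using IH(8) finR by (simp add: card_insert_if)
  then show ?case
    using q' len ends o IH(1,2,7) ear(4,5,7)
    by (intro exI[of _ ?xs] exI[of _ q'] exI[of _ ?us] exI[of _ "insert e R"]) auto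
qed

lemma excess_build:
  assumes "finite S" "h1 \<in> S \<rightarrow> {..<m}" "h2 \<in> S \<rightarrow> {..<m}"
    and "excess (cuckoo_graph m S h1 h2) \<ge> s + 1"
  obtains xs q us where "distinct xs" "set xs \<subseteq> S" "build m q (map key_edge xs) us"
     "length us + (s + 1) = length xs" "q \<le> 3 * (s + 1)"
  using build_ears[OF assms order_refl] by blast

end

section \<open>Probability estimates for the hash functions\<close>

lemma prob_bind_le_times:
  assumes "0 \<le> b" and "\<And>x. x \<in> set_pmf p \<Longrightarrow> x \<in> A \<Longrightarrow> measure_pmf.prob (q x) E \<le> b"
    and "\<And>x. x \<in> set_pmf p \<Longrightarrow> x \<notin> A \<Longrightarrow> measure_pmf.prob (q x) E = 0"
  shows "measure_pmf.prob (bind_pmf p q) E \<le> measure_pmf.prob p A * b"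
proof -
  have "emeasure (bind_pmf p q) E = (\<integral>\<^sup>+x. emeasure (q x) E \<partial>p)" by simp
  also have "\<dots> \<le> (\<integral>\<^sup>+x. ennreal b * indicator A x \<partial>p)"
    using assms by (intro nn_integral_mono_AE)
      (auto simp: AE_measure_pmf_iff measure_pmf.emeasure_eq_measure indicator_def)
  also have "\<dots> = ennreal b * emeasure p A" by (simp add: nn_integral_cmult_indicator)
  finally show ?thesis
    using \<open>0 \<le> b\<close>
    by (simp add: measure_pmf.emeasure_eq_measure ennreal_mult[symmetric] mult.commute)
qed

lemma prob_bind_le:
  assumes "0 \<le> b" and "\<And>x. x \<in> set_pmf p \<Longrightarrow> measure_pmf.prob (q x) E \<le> b"
  shows "measure_pmf.prob (bind_pmf p q) E \<le> b"
  using prob_bind_le_times[of b p UNIV q E] assms by simp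

lemma prob_mono_on_support:
  assumes "\<And>x. x \<in> set_pmf p \<Longrightarrow> x \<in> A \<Longrightarrow> x \<in> B"
  shows "measure_pmf.prob p A \<le> measure_pmf.prob p B"
proof -
  have "measure_pmf.prob p (A \<inter> set_pmf p) \<le> measure_pmf.prob p B"
    using assms by (intro measure_pmf.finite_measure_mono) auto
  then show ?thesis by (simp add: measure_Int_set_pmf)
qed

lemma prob_UNION_le:
  assumes "finite I" "\<And>x. x \<in> set_pmf p \<Longrightarrow> x \<in> A \<Longrightarrow> \<exists>i\<in>I. x \<in> B i"
    and "\<And>i. i \<in> I \<Longrightarrow> measure_pmf.prob p (B i) \<le> b"
  shows "measure_pmf.prob p A \<le> real (card I) * b"
proof -
  have "measure_pmf.prob p A \<le> measure_pmf.prob p (\<Union>i\<in>I. B i)"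
    using assms(2) by (intro prob_mono_on_support) auto
  also have "\<dots> \<le> (\<Sum>i\<in>I. measure_pmf.prob p (B i))"
    using assms(1) by (intro measure_UNION_le) auto
  also have "\<dots> \<le> (\<Sum>i\<in>I. b)" using assms(3) by (intro sum_mono)
  finally show ?thesis by simp
qed

text \<open>Independence speaks of exactly \<open>\<kappa>\<close> keys. \<open>B\<close> is
  enlarged to such a set, which \<open>\<kappa> \<le> card U\<close> permits, and the values of the
  added keys are summed out.\<close>

lemma indep_prob_le:
  assumes H: "indep_hash_family \<kappa> r U H" and U: "finite U" "\<kappa> \<le> card U"
    and B: "B \<subseteq> U" "card B \<le> \<kappa>"
  shows "measure_pmf.prob (pmf_of_multiset H) {h. \<forall>x\<in>B. h x = y x} \<le> 1 / real r ^ card B"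
proof -
  let ?p = "pmf_of_multiset H"
  have ne: "H \<noteq> {#}" and rng: "\<And>h x. h \<in> set_pmf ?p \<Longrightarrow> x \<in> U \<Longrightarrow> h x < r"
    using H by (auto simp: indep_hash_family_def)
  show ?thesis
  proof (cases "\<forall>x\<in>B. y x < r")
    case False
    then obtain x where x: "x \<in> B" "\<not> y x < r" by blast
    have "measure_pmf.prob ?p {h. \<forall>x\<in>B. h x = y x} \<le> measure_pmf.prob ?p {}"
      using rng x B by (intro prob_mono_on_support) fastforce
    then show ?thesis by (simp add: order_trans[of _ 0])
  next
    case True
    obtain B' where B': "B \<subseteq> B'" "B' \<subseteq> U" "card B' = \<kappa>"
      using exists_subset_between[OF B(2) U(2) B(1) U(1)] by metis
    have fin: "finite B'" "finite B"
      using finite_subset[OF B'(2) U(1)] finite_subset[OF B(1) U(1)] by simp_all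
    define y' where "y' w x = (if x \<in> B then y x else w x)" for w x
    let ?I = "PiE (B' - B) (\<lambda>_. {..<r})"
    have point: "measure_pmf.prob ?p {h. \<forall>x\<in>B'. h x = y' w x} = 1 / real r ^ \<kappa>" if w: "w \<in> ?I" for w
    proof -
      obtain xs where xs: "set xs = B'" "distinct xs" using fin(1) finite_distinct_list by blast
      have len: "length xs = \<kappa>" using xs B' distinct_card by metis
      have y': "y' w x < r" if "x \<in> B'" for x
        using True that w by (auto simp: y'_def)
      have "measure_pmf.prob ?p {h. \<forall>i<\<kappa>. h (xs ! i) = map (y' w) xs ! i} = 1 / real r ^ \<kappa>"
        by (rule H[unfolded indep_hash_family_def, THEN conjunct2, THEN conjunct2, rule_format])
           (use xs len B' y' in auto)
      moreover have "{h. \<forall>i<\<kappa>. h (xs ! i) = map (y' w) xs ! i} = {h. \<forall>x\<in>B'. h x = y' w x}"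
        using xs(1) len by (auto simp flip: xs(1) simp: all_set_conv_all_nth)
      ultimately show ?thesis by simp
    qed
    have "measure_pmf.prob ?p {h. \<forall>x\<in>B. h x = y x} \<le> real (card ?I) * (1 / real r ^ \<kappa>)"
    proof (rule prob_UNION_le)
      fix h assume h: "h \<in> set_pmf ?p" "h \<in> {h. \<forall>x\<in>B. h x = y x}"
      then show "\<exists>w\<in>?I. h \<in> {h. \<forall>x\<in>B'. h x = y' w x}"
        using rng B' by (intro bexI[of _ "restrict h (B' - B)"]) (auto simp: y'_def)
    qed (use fin point in \<open>auto intro: finite_PiE\<close>)
    also have "card ?I = r ^ (\<kappa> - card B)"
      using fin B' by (simp add: card_PiE card_Diff_subset)
    also have "real (r ^ (\<kappa> - card B)) * (1 / real r ^ \<kappa>) \<le> 1 / real r ^ card B"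
    proof (cases "r = 0")
      case False
      have "real r ^ \<kappa> = real r ^ (\<kappa> - card B) * real r ^ card B"
        using B(2) by (simp flip: power_add)
      then show ?thesis using False by simp
    next
      case r: True
      then have "B = {}" using True by auto
      then show ?thesis using r by (cases "\<kappa> = 0") auto
    qed
    finally show ?thesis .
  qed
qed

text \<open>A fibre of \<open>b\<close> \<ge> 2 keys contributes \<open>b - 1\<close> to the
  deficiency, which is at least \<open>b / 2\<close>.\<close>

lemma card_colliding_le:
  assumes "finite T"
  shows "card {x\<in>T. \<exists>y\<in>T. y \<noteq> x \<and> g y = g x} \<le> 2 * (card T - card (g ` T))"
proof -
  define B where "B = {x\<in>T. \<exists>y\<in>T. y \<noteq> x \<and> g y = g x}"
  have fin: "finite B" "B \<subseteq> T" using assms by (auto simp: B_def)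
  have "card (g ` (T - B)) = card (T - B)"
    by (intro card_image) (auto simp: inj_on_def B_def)
  moreover have "g ` T = g ` B \<union> g ` (T - B)" using fin by auto
  then have "card (g ` T) \<le> card (g ` B) + card (g ` (T - B))" by (simp add: card_Un_le)
  moreover have "card (T - B) = card T - card B" "card B \<le> card T"
    using fin assms by (simp_all add: card_Diff_subset card_mono)
  moreover have "2 * card (g ` B) \<le> card B"
  proof -
    have two: "2 \<le> card {x\<in>B. g x = v}" if v: "v \<in> g ` B" for v
    proof -
      obtain x y where xy: "x \<in> T" "y \<in> T" "y \<noteq> x" "g y = g x" "g x = v"
        using v by (auto simp: B_def)
      then have "{x, y} \<subseteq> {x\<in>B. g x = v}" by (auto simp: B_def)
      then have "card {x, y} \<le> card {x\<in>B. g x = v}" using fin by (intro card_mono) auto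
      then show ?thesis using xy by simp
    qed
    have "2 * card (g ` B) = (\<Sum>v\<in>g ` B. 2)" by simp
    also have "\<dots> \<le> (\<Sum>v\<in>g ` B. card {x\<in>B. g x = v})" using two by (rule sum_mono)
    also have "\<dots> = card B" using sum.image_gen[OF fin(1), of "\<lambda>_. 1::nat" g] by simp
    finally show ?thesis .
  qed
  ultimately show ?thesis unfolding B_def[symmetric] by linarith
qed

lemma add_mod_cancel_nat:
  fixes a a' b m :: nat
  assumes "a < m" "a' < m" "(a + b) mod m = (a' + b) mod m"
  shows "a = a'"
proof -
  have "a = a'" if "a \<ge> a'" "a < m" "(a + b) mod m = (a' + b) mod m" for a a'
  proof -
    have "m dvd a - a'" using that mod_eq_dvd_iff_nat[of "a' + b" "a + b" m] by simp
    then show ?thesis using that by (auto dest: dvd_imp_le)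
  qed
  then show ?thesis using assms by (metis nat_le_linear)
qed

text \<open>Since \<open>g\<close> is a bijection from \<open>T\<close> onto \<open>I\<close>, the
  event is a product over coordinates, and at most one value of each coordinate meets the condition
  of its key.\<close>

lemma prob_uniform_vector_le:
  assumes "finite I" "inj_on g T" "g ` T = I" "m > 0"
  shows "measure_pmf.prob (Pi_pmf I d (\<lambda>_. pmf_of_set {..<m}))
     {\<zeta>. \<forall>x\<in>T. (\<zeta> (g x) + a x) mod m = y x} \<le> 1 / real m ^ card T"
proof -
  let ?B = "\<lambda>v. {u. (u + a (the_inv_into T g v)) mod m = y (the_inv_into T g v)}"
  have "{\<zeta>. \<forall>x\<in>T. (\<zeta> (g x) + a x) mod m = y x} = Pi I ?B"
    using assms(2) by (auto simp: assms(3)[symmetric] the_inv_into_f_f Pi_iff)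
  then have "measure_pmf.prob (Pi_pmf I d (\<lambda>_. pmf_of_set {..<m}))
     {\<zeta>. \<forall>x\<in>T. (\<zeta> (g x) + a x) mod m = y x} = (\<Prod>v\<in>I. measure_pmf.prob (pmf_of_set {..<m}) (?B v))"
    using assms(1) by (simp add: measure_Pi_pmf_Pi)
  also have "\<dots> \<le> (\<Prod>v\<in>I. 1 / real m)"
  proof (rule prod_mono, intro conjI)
    fix v assume "v \<in> I"
    have "card ({..<m} \<inter> ?B v) \<le> Suc 0"
      unfolding card_le_Suc0_iff_eq[OF finite_Int[OF disjI1[OF finite_lessThan]]]
    proof (intro ballI)
      fix b b' assume "b \<in> {..<m} \<inter> ?B v" "b' \<in> {..<m} \<inter> ?B v"
      then show "b = b'" using add_mod_cancel_nat[of b m b' "a (the_inv_into T g v)"] by simp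
    qed
    then have "real (card ({..<m} \<inter> ?B v)) \<le> 1" by simp
    then show "measure_pmf.prob (pmf_of_set {..<m}) (?B v) \<le> 1 / real m"
      using \<open>m > 0\<close> by (subst measure_pmf_of_set) (auto intro!: divide_right_mono)
  qed auto
  also have "\<dots> = 1 / real m ^ card T"
    using assms(2,3) card_image[of g T] by (simp add: power_one_over)
  finally show ?thesis .
qed

text \<open>The default \<open>undefined\<close> is the value of extensional functions off their
  domain, so the uniform extensional vector is a product distribution.\<close>

lemma pmf_of_set_PiE_split:
  fixes m :: nat
  assumes "finite A" "finite B" "A \<inter> B = {}" "m > 0"
  shows "pmf_of_set ((A \<union> B) \<rightarrow>\<^sub>E {..<m}) = do {
     u \<leftarrow> Pi_pmf A undefined (\<lambda>_. pmf_of_set {..<m});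
     v \<leftarrow> Pi_pmf B undefined (\<lambda>_. pmf_of_set {..<m});
     return_pmf (\<lambda>x. if x \<in> A then u x else v x)}"
proof -
  have "PiE_dflt (A \<union> B) undefined (\<lambda>_. {..<m}) = (A \<union> B) \<rightarrow>\<^sub>E {..<m}"
    by (auto simp: PiE_dflt_def PiE_def extensional_def)
  then have "pmf_of_set ((A \<union> B) \<rightarrow>\<^sub>E {..<m}) =
      Pi_pmf (A \<union> B) undefined (\<lambda>_. pmf_of_set {..<m})"
    using assms by (subst Pi_pmf_of_set) auto
  then show ?thesis
    using assms by (simp add: Pi_pmf_union pair_pmf_def map_pmf_def bind_assoc_pmf bind_return_pmf)
qed

text \<open>
  At most \<open>2 * k\<close> keys of \<open>T\<close> share their \<open>g\<close>-value with another key; these are randomised by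
  \<open>f\<close>, while every other key is randomised by an entry of the vector that no other key reads.
\<close>

lemma prob_hash_vector_le:
  fixes m l :: nat
  assumes F: "indep_hash_family (2 * k) m U F" and U: "finite U" "2 * k \<le> card U"
    and T: "T \<subseteq> U" "g \<in> T \<rightarrow> {..<l}" "card T - card (g ` T) \<le> k" and m: "m > 0"
  shows "measure_pmf.prob (do {
      f \<leftarrow> pmf_of_multiset F;
      \<zeta> \<leftarrow> pmf_of_set ({..<l} \<rightarrow>\<^sub>E {..<m});
      return_pmf (\<lambda>x. (f x + (\<zeta> (g x) + a x)) mod m)}) {h. \<forall>x\<in>T. h x = y x} \<le> 1 / real m ^ card T"
proof -
  let ?F = "pmf_of_multiset F" and ?V = "\<lambda>A. Pi_pmf A undefined (\<lambda>_. pmf_of_set {..<m})"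
  have finT: "finite T" using T U finite_subset by blast
  have rng: "\<And>f x. f \<in> set_pmf ?F \<Longrightarrow> x \<in> U \<Longrightarrow> f x < m"
    using F by (auto simp: indep_hash_family_def)
  define B where "B = {x\<in>T. \<exists>y\<in>T. y \<noteq> x \<and> g y = g x}"
  define I0 where "I0 = g ` (T - B)"
  define I1 where "I1 = {..<l} - I0"
  have B: "B \<subseteq> T" "finite B" "card B \<le> 2 * k"
    using finT card_colliding_le[OF finT, of g] T(3) by (auto simp: B_def)
  have I0: "I0 \<subseteq> {..<l}" "finite I0" using T(2) finT by (auto simp: I0_def)
  then have split: "{..<l} = I1 \<union> I0" "finite I1" "I1 \<inter> I0 = {}" by (auto simp: I1_def)
  have gB: "g x \<in> I1" if "x \<in> B" for x
  proof -
    have "g x \<noteq> g x'" if x': "x' \<in> T - B" for x'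
    proof
      assume eq: "g x = g x'"
      have "x \<noteq> x'" using \<open>x \<in> B\<close> x' by blast
      then have "x' \<in> B" using eq \<open>x \<in> B\<close> x' by (auto simp: B_def)
      then show False using x' by blast
    qed
    then show ?thesis using that T(2) B(1) by (auto simp: I1_def I0_def)
  qed
  have gT: "g x \<notin> I1" if "x \<in> T - B" for x
    using that by (auto simp: I1_def I0_def)
  have inj: "inj_on g (T - B)" by (auto simp: inj_on_def B_def)
  \<comment> \<open>The order of the draws matters. Once the entries \<open>u\<close> outside
    \<open>I0\<close> are fixed, the condition on \<open>B\<close> involves \<open>f\<close> alone;
    once \<open>f\<close> is fixed too, the condition on \<open>T - B\<close> involves only the
    entries at \<open>I0\<close>.\<close>
  have inner: "measure_pmf.prob (bind_pmf ?F (\<lambda>f. bind_pmf (?V I0) (\<lambda>v.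
        return_pmf (\<lambda>x. (f x + ((if g x \<in> I1 then u (g x) else v (g x)) + a x)) mod m))))
      {h. \<forall>x\<in>T. h x = y x} \<le> 1 / real m ^ card B * (1 / real m ^ card (T - B))" (is "?lhs \<le> _") for u
  proof -
    define A where "A = {f. \<forall>x\<in>B. (f x + (u (g x) + a x)) mod m = y x}"
    have "?lhs \<le> measure_pmf.prob ?F A * (1 / real m ^ card (T - B))"
    proof (rule prob_bind_le_times)
      fix f
      let ?Q = "bind_pmf (?V I0) (\<lambda>v.
        return_pmf (\<lambda>x. (f x + ((if g x \<in> I1 then u (g x) else v (g x)) + a x)) mod m))"
      have Q: "measure_pmf.prob ?Q E = measure_pmf.prob (?V I0)
          {v. (\<lambda>x. (f x + ((if g x \<in> I1 then u (g x) else v (g x)) + a x)) mod m) \<in> E}" for E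
        by (simp add: map_pmf_def[symmetric] vimage_def)
      {
        have "measure_pmf.prob ?Q {h. \<forall>x\<in>T. h x = y x} \<le>
            measure_pmf.prob (?V I0) {v. \<forall>x\<in>T - B. (v (g x) + (f x + a x)) mod m = y x}"
          unfolding Q using gT by (intro measure_pmf.finite_measure_mono) (auto simp: ac_simps)
        also have "\<dots> \<le> 1 / real m ^ card (T - B)"
          by (intro prob_uniform_vector_le) (use I0 inj m in \<open>auto simp: I0_def\<close>)
        finally show "measure_pmf.prob ?Q {h. \<forall>x\<in>T. h x = y x} \<le> 1 / real m ^ card (T - B)" .
      }
      assume "f \<notin> A"
      then obtain x where x: "x \<in> B" "(f x + (u (g x) + a x)) mod m \<noteq> y x" by (auto simp: A_def)
      then have emp: "{v. (\<lambda>x. (f x + ((if g x \<in> I1 then u (g x) else v (g x)) + a x)) mod m)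
          \<in> {h. \<forall>x\<in>T. h x = y x}} = {}"
        using gB[OF x(1)] B(1) by auto
      then show "measure_pmf.prob ?Q {h. \<forall>x\<in>T. h x = y x} = 0" unfolding Q emp by simp
    qed auto
    also have "measure_pmf.prob ?F A \<le> 1 / real m ^ card B"
    proof -
      \<comment> \<open>The only value of \<open>f x\<close> that can yield \<open>y x\<close>. If
        no value does, the choice is arbitrary and the event is impossible.\<close>
      define w where "w x = (SOME e. e < m \<and> (e + (u (g x) + a x)) mod m = y x)" for x
      have w: "e = w x" if "e < m" "(e + (u (g x) + a x)) mod m = y x" for x e
      proof -
        have "w x < m \<and> (w x + (u (g x) + a x)) mod m = y x"
          unfolding w_def by (rule someI[of _ e]) (use that in simp)
        then show ?thesis using that add_mod_cancel_nat[of e m "w x" "u (g x) + a x"] by simp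
      qed
      have "measure_pmf.prob ?F A \<le> measure_pmf.prob ?F {f. \<forall>x\<in>B. f x = w x}"
        using w rng B(1) T(1) by (intro prob_mono_on_support) (auto simp: A_def)
      also have "\<dots> \<le> 1 / real m ^ card B"
        using indep_prob_le[OF F U] B T(1) by auto
      finally show ?thesis .
    qed
    finally show ?thesis by (simp add: mult_right_mono divide_right_mono)
  qed
  have "card B + card (T - B) = card T" using B finT by (simp add: card_Diff_subset card_mono)
  then have eq: "1 / real m ^ card B * (1 / real m ^ card (T - B)) = 1 / real m ^ card T"
    by (simp flip: power_add)
  have split_eq: "(do {
      f \<leftarrow> ?F;
      \<zeta> \<leftarrow> pmf_of_set ({..<l} \<rightarrow>\<^sub>E {..<m});
      return_pmf (\<lambda>x. (f x + (\<zeta> (g x) + a x)) mod m)}) =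
     bind_pmf (?V I1) (\<lambda>u. bind_pmf ?F (\<lambda>f. bind_pmf (?V I0) (\<lambda>v.
        return_pmf (\<lambda>x. (f x + ((if g x \<in> I1 then u (g x) else v (g x)) + a x)) mod m))))"
    unfolding split(1) pmf_of_set_PiE_split[OF split(2) I0(2) split(3) m]
    by (simp add: bind_assoc_pmf bind_return_pmf bind_commute_pmf[of ?F])
  show ?thesis
    unfolding split_eq by (rule prob_bind_le) (simp, rule inner[unfolded eq])
qed

section \<open>Hash values conditioned on \<open>g\<close>\<close>

definition hash_given :: "nat \<Rightarrow> nat \<Rightarrow> nat \<Rightarrow> ('a \<Rightarrow> nat) multiset \<Rightarrow> (nat \<Rightarrow> 'a \<Rightarrow> nat) \<Rightarrow> ('a \<Rightarrow> nat) pmf" where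
  "hash_given c l m F g = do {
     f \<leftarrow> pmf_of_multiset F;
     z \<leftarrow> Pi_pmf {1..c} undefined (\<lambda>_. pmf_of_set ({..<l} \<rightarrow>\<^sub>E {..<m}));
     return_pmf (Z_hash c m f g z)}"

text \<open>The two hash functions share only \<open>g\<close>; once it is drawn, they are
  independent copies of one distribution.\<close>

lemma Z_pmf_conv:
  "Z_pmf c l m F G = do {
     g \<leftarrow> Pi_pmf {1..c} undefined (\<lambda>_. pmf_of_multiset G);
     h1 \<leftarrow> hash_given c l m F g;
     h2 \<leftarrow> hash_given c l m F g;
     return_pmf (h1, h2)}"
proof -
  let ?F = "pmf_of_multiset F" and ?G = "Pi_pmf {1..c} undefined (\<lambda>_. pmf_of_multiset G)"
  let ?Z = "Pi_pmf {1..c} undefined (\<lambda>_. pmf_of_set ({..<l} \<rightarrow>\<^sub>E {..<m}))"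
  have "Z_pmf c l m F G = bind_pmf ?F (\<lambda>f1. bind_pmf ?G (\<lambda>g. bind_pmf ?F (\<lambda>f2. bind_pmf ?Z (\<lambda>z1.
      bind_pmf ?Z (\<lambda>z2. return_pmf (Z_hash c m f1 g z1, Z_hash c m f2 g z2))))))"
    unfolding Z_pmf_def by (subst (2) bind_commute_pmf) rule
  also have "\<dots> = bind_pmf ?G (\<lambda>g. bind_pmf ?F (\<lambda>f1. bind_pmf ?F (\<lambda>f2. bind_pmf ?Z (\<lambda>z1.
      bind_pmf ?Z (\<lambda>z2. return_pmf (Z_hash c m f1 g z1, Z_hash c m f2 g z2))))))"
    by (rule bind_commute_pmf)
  also have "\<dots> = bind_pmf ?G (\<lambda>g. bind_pmf ?F (\<lambda>f1. bind_pmf ?Z (\<lambda>z1. bind_pmf ?F (\<lambda>f2. 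
      bind_pmf ?Z (\<lambda>z2. return_pmf (Z_hash c m f1 g z1, Z_hash c m f2 g z2))))))"
    by (intro bind_pmf_cong refl bind_commute_pmf)
  finally show ?thesis
    by (simp add: hash_given_def bind_assoc_pmf bind_return_pmf)
qed

text \<open>One index \<open>j\<close> of small deficiency suffices: with the other vectors fixed,
  their contribution is an offset depending only on the key.\<close>

lemma prob_hash_given_le:
  assumes F: "indep_hash_family (2 * k) m U F" and U: "finite U" "2 * k \<le> card U"
    and T: "T \<subseteq> U" and j: "j \<in> {1..c}" "g j \<in> T \<rightarrow> {..<l}" "card T - card (g j ` T) \<le> k" and m: "m > 0"
  shows "measure_pmf.prob (hash_given c l m F g) {h. \<forall>x\<in>T. h x = y x} \<le> 1 / real m ^ card T"
proof -
  let ?F = "pmf_of_multiset F" and ?u = "pmf_of_set ({..<l} \<rightarrow>\<^sub>E {..<m})"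
  let ?J = "{1..c} - {j}"
  let ?Z = "Pi_pmf ?J undefined (\<lambda>_. ?u)"
  have ins: "{1..c} = insert j ?J" using j by auto
  have Zh: "Z_hash c m f g (z(j := \<zeta>)) = (\<lambda>x. (f x + (\<zeta> (g j x) + (\<Sum>i\<in>?J. z i (g i x)))) mod m)" for f z \<zeta>
  proof
    fix x
    have "(\<Sum>i=1..c. (z(j := \<zeta>)) i (g i x)) = \<zeta> (g j x) + (\<Sum>i\<in>?J. (z(j := \<zeta>)) i (g i x))"
      using j by (subst sum.remove[of _ j]) auto
    also have "(\<Sum>i\<in>?J. (z(j := \<zeta>)) i (g i x)) = (\<Sum>i\<in>?J. z i (g i x))"
      by (intro sum.cong) auto
    finally show "Z_hash c m f g (z(j := \<zeta>)) x = (f x + (\<zeta> (g j x) + (\<Sum>i\<in>?J. z i (g i x)))) mod m"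
      by (simp add: Z_hash_def)
  qed
  have "Pi_pmf {1..c} undefined (\<lambda>_. ?u) = bind_pmf ?u (\<lambda>\<zeta>. bind_pmf ?Z (\<lambda>z. return_pmf (z(j := \<zeta>))))"
    by (subst ins, subst Pi_pmf_insert') auto
  then have "hash_given c l m F g = bind_pmf ?F (\<lambda>f. bind_pmf ?u (\<lambda>\<zeta>. bind_pmf ?Z (\<lambda>z.
      return_pmf (\<lambda>x. (f x + (\<zeta> (g j x) + (\<Sum>i\<in>?J. z i (g i x)))) mod m))))"
    by (simp add: hash_given_def bind_assoc_pmf bind_return_pmf Zh)
  also have "\<dots> = bind_pmf ?F (\<lambda>f. bind_pmf ?Z (\<lambda>z. bind_pmf ?u (\<lambda>\<zeta>.
      return_pmf (\<lambda>x. (f x + (\<zeta> (g j x) + (\<Sum>i\<in>?J. z i (g i x)))) mod m))))"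
    by (intro bind_pmf_cong refl bind_commute_pmf)
  also have "\<dots> = bind_pmf ?Z (\<lambda>z. bind_pmf ?F (\<lambda>f. bind_pmf ?u (\<lambda>\<zeta>.
      return_pmf (\<lambda>x. (f x + (\<zeta> (g j x) + (\<Sum>i\<in>?J. z i (g i x)))) mod m))))"
    by (rule bind_commute_pmf)
  finally show ?thesis
    by (rule ssubst) (intro prob_bind_le prob_hash_vector_le[OF F U T j(2,3) m], simp)
qed

lemma prob_hash_pair_le:
  assumes F: "indep_hash_family (2 * k) m U F" and U: "finite U" "2 * k \<le> card U"
    and T: "T \<subseteq> U" and j: "j \<in> {1..c}" "g j \<in> T \<rightarrow> {..<l}" "card T - card (g j ` T) \<le> k" and m: "m > 0"
  shows "measure_pmf.prob (do {h1 \<leftarrow> hash_given c l m F g; h2 \<leftarrow> hash_given c l m F g; return_pmf (h1, h2)})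
      {(h1, h2). \<forall>x\<in>T. (h1 x, h2 x) = y x} \<le> 1 / real m ^ (2 * card T)"
proof -
  let ?H = "hash_given c l m F g"
  note le = prob_hash_given_le[where g = g and j = j, OF F U T j m]
  have "measure_pmf.prob (bind_pmf ?H (\<lambda>h1. bind_pmf ?H (\<lambda>h2. return_pmf (h1, h2))))
      {(h1, h2). \<forall>x\<in>T. (h1 x, h2 x) = y x} \<le>
    measure_pmf.prob ?H {h. \<forall>x\<in>T. h x = fst (y x)} * (1 / real m ^ card T)"
  proof (rule prob_bind_le_times)
    fix h1 :: "'a \<Rightarrow> nat"
    have Q: "measure_pmf.prob (bind_pmf ?H (\<lambda>h2. return_pmf (h1, h2))) E =
        measure_pmf.prob ?H {h2. (h1, h2) \<in> E}" for E :: "(('a \<Rightarrow> nat) \<times> ('a \<Rightarrow> nat)) set"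
      by (simp add: map_pmf_def[symmetric] vimage_def)
    have "measure_pmf.prob ?H {h2. (h1, h2) \<in> {(h1, h2). \<forall>x\<in>T. (h1 x, h2 x) = y x}} \<le>
        measure_pmf.prob ?H {h. \<forall>x\<in>T. h x = snd (y x)}"
      by (intro measure_pmf.finite_measure_mono) (auto simp: prod_eq_iff)
    then show "measure_pmf.prob (bind_pmf ?H (\<lambda>h2. return_pmf (h1, h2))) {(h1, h2). \<forall>x\<in>T. (h1 x, h2 x) = y x}
        \<le> 1 / real m ^ card T"
      unfolding Q using le[of "\<lambda>x. snd (y x)"] by linarith
    assume "h1 \<notin> {h. \<forall>x\<in>T. h x = fst (y x)}"
    then have emp: "{h2. (h1, h2) \<in> {(h1, h2). \<forall>x\<in>T. (h1 x, h2 x) = y x}} = {}"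
      by (auto simp: prod_eq_iff)
    then show "measure_pmf.prob (bind_pmf ?H (\<lambda>h2. return_pmf (h1, h2))) {(h1, h2). \<forall>x\<in>T. (h1 x, h2 x) = y x} = 0"
      unfolding Q emp by simp
  qed auto
  also have "\<dots> \<le> 1 / real m ^ card T * (1 / real m ^ card T)"
    by (intro mult_right_mono le) auto
  also have "\<dots> = 1 / real m ^ (2 * card T)"
    by (simp add: mult_2 power_add)
  finally show ?thesis .
qed

section \<open>Probability of many collisions\<close>

text \<open>
  The star forest \<open>{y, r y}\<close> has \<open>k\<close> edges on at most \<open>2 * k\<close> keys, so \<open>2 * k\<close>-wise independence
  treats its edges as independent.
\<close>

lemma prob_pairs_collide_le:
  assumes G: "indep_hash_family (2 * k) l U G" and U: "finite U" "2 * k \<le> card U" and l: "l > 0"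
    and Y: "Y \<subseteq> U" "card Y = k" and r: "r \<in> Y \<rightarrow> U - Y"
  shows "measure_pmf.prob (pmf_of_multiset G) {g. \<forall>y\<in>Y. g y = g (r y)} \<le> 1 / real l ^ k"
proof -
  let ?p = "pmf_of_multiset G"
  have rng: "\<And>h x. h \<in> set_pmf ?p \<Longrightarrow> x \<in> U \<Longrightarrow> h x < l"
    using G by (auto simp: indep_hash_family_def)
  have fin: "finite Y" using Y U finite_subset by blast
  have disj: "Y \<inter> r ` Y = {}" using r by auto
  have cr: "card (r ` Y) \<le> k" using fin Y card_image_le by blast
  have cYr: "card (Y \<union> r ` Y) = k + card (r ` Y)"
    using fin disj Y by (simp add: card_Un_disjoint)
  define w' where "w' w x = (if x \<in> Y then w (r x) else w x)" for w :: "'a \<Rightarrow> nat" and x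
  have "measure_pmf.prob ?p {g. \<forall>y\<in>Y. g y = g (r y)} \<le>
      real (card (r ` Y \<rightarrow>\<^sub>E {..<l})) * (1 / real l ^ (k + card (r ` Y)))"
  proof (rule prob_UNION_le)
    fix g assume g: "g \<in> set_pmf ?p" "g \<in> {g. \<forall>y\<in>Y. g y = g (r y)}"
    show "\<exists>w\<in>r ` Y \<rightarrow>\<^sub>E {..<l}. g \<in> {g. \<forall>x\<in>Y \<union> r ` Y. g x = w' w x}"
      using g rng r disj by (intro bexI[of _ "restrict g (r ` Y)"]) (auto simp: w'_def)
  next
    fix w
    show "measure_pmf.prob ?p {g. \<forall>x\<in>Y \<union> r ` Y. g x = w' w x} \<le> 1 / real l ^ (k + card (r ` Y))"
      using indep_prob_le[OF G U, of "Y \<union> r ` Y" "w' w"] Y r cr cYr by auto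
  qed (use fin in \<open>auto intro: finite_PiE\<close>)
  also have "\<dots> = 1 / real l ^ k"
    using fin l by (simp add: card_PiE power_add)
  finally show ?thesis .
qed

text \<open>One representative per fibre is chosen. Deficiency at least \<open>k\<close> leaves
  \<open>k\<close> keys that are not representatives, each colliding with its representative, which
  lies outside these \<open>k\<close> keys. At most \<open>card T ^ k\<close> sets and
  \<open>card T ^ k\<close> maps are possible.\<close>

lemma prob_deficiency_le:
  assumes G: "indep_hash_family (2 * k) l U G" and U: "finite U" "2 * k \<le> card U" and l: "l > 0"
    and T: "T \<subseteq> U"
  shows "measure_pmf.prob (pmf_of_multiset G) {g. k \<le> card T - card (g ` T)} \<le> real (card T) ^ (2 * k) / real l ^ k"
proof -
  have finT: "finite T" using T U finite_subset by blast
  define I where "I = (SIGMA Y:{Y. Y \<subseteq> T \<and> card Y = k}. Y \<rightarrow>\<^sub>E (T - Y))"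
  have finI: "finite I"
    using finT unfolding I_def by (intro finite_SigmaI finite_PiE) (auto intro: finite_subset)
  have "card I = (\<Sum>Y\<in>{Y. Y \<subseteq> T \<and> card Y = k}. card (Y \<rightarrow>\<^sub>E (T - Y)))"
    unfolding I_def using finT by (intro card_SigmaI ballI finite_PiE) (auto intro: finite_subset)
  also have "\<dots> \<le> (\<Sum>Y\<in>{Y. Y \<subseteq> T \<and> card Y = k}. card T ^ k)"
  proof (rule sum_mono)
    fix Y assume "Y \<in> {Y. Y \<subseteq> T \<and> card Y = k}"
    then have "finite Y" "card Y = k" using finT by (auto intro: finite_subset)
    then have "card (Y \<rightarrow>\<^sub>E (T - Y)) = card (T - Y) ^ k"
      by (simp add: card_PiE)
    also have "\<dots> \<le> card T ^ k" using finT by (intro power_mono card_mono) auto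
    finally show "card (Y \<rightarrow>\<^sub>E (T - Y)) \<le> card T ^ k" .
  qed
  also have "\<dots> = (card T choose k) * card T ^ k" using finT by (simp add: n_subsets)
  also have "\<dots> \<le> card T ^ k * card T ^ k"
    by (cases "k \<le> card T") (auto intro: mult_right_mono binomial_le_pow simp: binomial_eq_0)
  finally have cardI: "card I \<le> card T ^ (2 * k)" by (simp add: mult_2 power_add)
  have "measure_pmf.prob (pmf_of_multiset G) {g. k \<le> card T - card (g ` T)} \<le> real (card I) * (1 / real l ^ k)"
  proof (rule prob_UNION_le[OF finI])
    fix g :: "'a \<Rightarrow> nat" assume g: "g \<in> {g. k \<le> card T - card (g ` T)}"
    define \<rho> where "\<rho> = inv_into T g"
    have \<rho>: "\<rho> (g x) \<in> T" "g (\<rho> (g x)) = g x" if "x \<in> T" for x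
      using that by (auto simp: \<rho>_def inv_into_into f_inv_into_f)
    define R where "R = \<rho> ` g ` T"
    have "card R \<le> card (g ` T)" "R \<subseteq> T" using finT \<rho> by (auto simp: R_def card_image_le)
    then have "k \<le> card (T - R)" using g finT by (simp add: card_Diff_subset finite_subset)
    then obtain Y where Y: "Y \<subseteq> T - R" "card Y = k"
      by (metis obtain_subset_with_card_n)
    have "\<rho> (g y) \<in> T - Y" if "y \<in> Y" for y
    proof -
      have "y \<in> T" using that Y by auto
      then have "\<rho> (g y) \<in> R" by (auto simp: R_def)
      then show ?thesis using \<rho> \<open>y \<in> T\<close> Y by auto
    qed
    then have "(Y, restrict (\<lambda>y. \<rho> (g y)) Y) \<in> I"
      using Y by (auto simp: I_def)
    moreover have "\<forall>y\<in>Y. g y = g (restrict (\<lambda>y. \<rho> (g y)) Y y)"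
      using \<rho> Y by auto
    ultimately show "\<exists>i\<in>I. g \<in> {g. \<forall>y\<in>fst i. g y = g (snd i y)}"
      by (intro bexI[of _ "(Y, restrict (\<lambda>y. \<rho> (g y)) Y)"]) simp_all
  next
    fix i assume "i \<in> I"
    then show "measure_pmf.prob (pmf_of_multiset G) {g. \<forall>y\<in>fst i. g y = g (snd i y)} \<le> 1 / real l ^ k"
      using T by (intro prob_pairs_collide_le[OF G U l]) (auto simp: I_def PiE_def Pi_def)
  qed
  also have "\<dots> \<le> real (card T ^ (2 * k)) * (1 / real l ^ k)"
    using cardI by (intro mult_right_mono) (auto simp del: of_nat_power)
  finally show ?thesis by simp
qed

lemma prob_all_deficient_le:
  assumes G: "indep_hash_family (2 * k) l U G" and U: "finite U" "2 * k \<le> card U" and l: "l > 0"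
    and T: "T \<subseteq> U"
  shows "measure_pmf.prob (Pi_pmf {1..c} d (\<lambda>_. pmf_of_multiset G))
     {g. \<forall>j\<in>{1..c}. k \<le> card T - card (g j ` T)} \<le> (real (card T) ^ (2 * k) / real l ^ k) ^ c"
proof -
  let ?E = "{g. k \<le> card T - card (g ` T)}"
  have "{g :: nat \<Rightarrow> 'a \<Rightarrow> nat. \<forall>j\<in>{1..c}. k \<le> card T - card (g j ` T)} = Pi {1..c} (\<lambda>_. ?E)"
    by auto
  then have "measure_pmf.prob (Pi_pmf {1..c} d (\<lambda>_. pmf_of_multiset G))
     {g. \<forall>j\<in>{1..c}. k \<le> card T - card (g j ` T)} = (\<Prod>j\<in>{1..c}. measure_pmf.prob (pmf_of_multiset G) ?E)"
    by (simp only: measure_Pi_pmf_Pi finite_atLeastAtMost)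
  also have "\<dots> \<le> (real (card T) ^ (2 * k) / real l ^ k) ^ c"
    using prob_deficiency_le[OF G U l T] by (auto intro: power_mono)
  finally show ?thesis .
qed

section \<open>Union bound\<close>

text \<open>
  Dropping one key lowers each \<open>card T - card (g j ` T)\<close> by at most one.
\<close>

lemma critical_suffix:
  assumes "distinct xs" "k \<ge> 1" "J \<noteq> {}" "\<forall>j\<in>J. k \<le> card (set xs) - card (g j ` set xs)"
  shows "\<exists>i. drop i xs \<noteq> [] \<and>
    (\<forall>j\<in>J. k \<le> card (set (drop i xs)) - card (g j ` set (drop i xs))) \<and>
    (\<exists>j\<in>J. card (set (drop i xs)) - card (g j ` set (drop i xs)) \<le> k)"
  using assms
proof (induction xs)
  case Nil
  then show ?case by auto
next
  case (Cons x xs)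
  show ?case
  proof (cases "\<forall>j\<in>J. k \<le> card (set xs) - card (g j ` set xs)")
    case True
    then obtain i where "drop i xs \<noteq> [] \<and>
      (\<forall>j\<in>J. k \<le> card (set (drop i xs)) - card (g j ` set (drop i xs))) \<and>
      (\<exists>j\<in>J. card (set (drop i xs)) - card (g j ` set (drop i xs)) \<le> k)"
      using Cons by auto
    then show ?thesis by (intro exI[of _ "Suc i"]) simp
  next
    case False
    then obtain j where j: "j \<in> J" "card (set xs) - card (g j ` set xs) < k" by force
    have "card (g j ` set xs) \<le> card (g j ` set (x # xs))" by (intro card_mono) auto
    moreover have "card (set (x # xs)) = Suc (card (set xs))" using Cons.prems by simp
    ultimately have "card (set (x # xs)) - card (g j ` set (x # xs)) \<le> k" using j(2) by linarith
    then show ?thesis using Cons.prems j(1) by (intro exI[of _ 0]) (simp del: set_simps, blast)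
  qed
qed

text \<open>Differentiating the power series and multiplying by \<open>x\<close> raises the degree
  of the coefficients by one.\<close>

lemma summable_power_times_geometric:
  fixes x :: real
  assumes "\<bar>x\<bar> < 1"
  shows "summable (\<lambda>n. real n ^ d * x ^ n)"
  using assms
proof (induction d arbitrary: x)
  case 0
  then show ?case by (simp add: summable_geometric)
next
  case (Suc d)
  have "summable (\<lambda>n. diffs (\<lambda>n. real n ^ d) n * x ^ n)"
    by (rule termdiff_converges[of x 1]) (use Suc in auto)
  then have sm: "summable (\<lambda>n. x * (diffs (\<lambda>n. real n ^ d) n * x ^ n))" by (rule summable_mult)
  have eq: "x * (diffs (\<lambda>n. real n ^ d) n * x ^ n) = real (Suc n) ^ Suc d * x ^ Suc n" for n
    by (simp add: diffs_def mult_ac)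
  have "summable (\<lambda>n. real (Suc n) ^ Suc d * x ^ Suc n)" using sm unfolding eq .
  then show ?case by (subst (asm) summable_Suc_iff)
qed

lemma summable_shifted_power_times_geometric:
  fixes x :: real
  assumes "0 < x" "x < 1"
  shows "summable (\<lambda>n. real (n + 2) ^ d * x ^ n)"
proof -
  have "summable (\<lambda>n. real (n + 2) ^ d * x ^ (n + 2))"
    using summable_ignore_initial_segment[OF summable_power_times_geometric[of x d], of 2] assms by simp
  then have sm: "summable (\<lambda>n. real (n + 2) ^ d * x ^ (n + 2) / x\<^sup>2)" by (rule summable_divide)
  have eq: "real (n + 2) ^ d * x ^ (n + 2) / x\<^sup>2 = real (n + 2) ^ d * x ^ n" for n
    using assms by (simp add: power2_eq_square)
  show ?thesis using sm unfolding eq .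
qed

definition traces :: "nat \<Rightarrow> nat \<Rightarrow> nat \<Rightarrow> nat set \<Rightarrow> (nat \<times> nat) list set" where
  "traces m K t V = {es. \<exists>q us. build m q es us \<and> q \<le> K \<and> length es = t \<and> length us \<in> V}"

text \<open>The factor \<open>(t + 1) * (2 + t\<^sup>2)\<close> per move is at most
  \<open>(t + 2) ^ 3\<close>, hence the exponent \<open>3 * K\<close>. Later
  \<open>K = 3 * (s + 1)\<close>, with three moves for each of \<open>s + 1\<close> ears, gives
  \<open>9 * (s + 1)\<close>.\<close>

lemma card_traces:
  assumes "finite V" "\<And>v. v \<in> V \<Longrightarrow> v \<le> w" "m \<ge> 1"
  shows "finite (traces m K t V)" 
    and "card (traces m K t V) \<le> (K + 1) * card V * (t + 2) ^ (3 * K) * m ^ w"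
proof -
  let ?I = "{..K} \<times> V"
  have sub: "traces m K t V \<subseteq> (\<Union>(q, v)\<in>?I. fst ` builds m q t v)"
    by (force simp: traces_def builds_def)
  have fin: "finite (\<Union>(q, v)\<in>?I. fst ` builds m q t v)"
    using assms(1) card_builds[of t t] by (auto intro!: finite_UN_I)
  then show "finite (traces m K t V)" using sub finite_subset by blast
  have "(t + 1) * (2 + t\<^sup>2) \<le> (t + 2) ^ 3"
    by (simp add: power2_eq_square power3_eq_cube algebra_simps)
  have "card (traces m K t V) \<le> card (\<Union>(q, v)\<in>?I. fst ` builds m q t v)"
    using sub fin by (rule card_mono[rotated])
  also have "\<dots> \<le> (\<Sum>p\<in>?I. card (case p of (q, v) \<Rightarrow> fst ` builds m q t v))"
    using assms(1) by (intro card_UN_le) auto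
  also have "\<dots> \<le> (\<Sum>p\<in>?I. (t + 2) ^ (3 * K) * m ^ w)"
  proof (rule sum_mono)
    fix p assume "p \<in> ?I"
    then obtain q v where p: "p = (q, v)" "q \<in> {..K}" "v \<in> V" by auto
    have "card (fst ` builds m q t v) \<le> card (builds m q t v)"
      using card_builds[of t t] by (intro card_image_le) auto
    also have "\<dots> \<le> ((t + 1) * (2 + t\<^sup>2)) ^ q * m ^ v" using card_builds[of t t] by auto
    also have "\<dots> \<le> ((t + 2) ^ 3) ^ q * m ^ w"
      using \<open>(t + 1) * (2 + t\<^sup>2) \<le> (t + 2) ^ 3\<close> assms(2)[OF p(3)] assms(3)
      by (intro mult_le_mono power_mono power_increasing) auto
    also have "((t + 2) ^ 3) ^ q \<le> (t + 2) ^ (3 * K)"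
      using p(2) by (subst power_mult[symmetric], intro power_increasing) auto
    finally show "card (case p of (q, v) \<Rightarrow> fst ` builds m q t v) \<le> (t + 2) ^ (3 * K) * m ^ w"
      by (simp add: p(1))
  qed
  also have "\<dots> = (K + 1) * card V * (t + 2) ^ (3 * K) * m ^ w"
    by (simp add: card_cartesian_product)
  finally show "card (traces m K t V) \<le> (K + 1) * card V * (t + 2) ^ (3 * K) * m ^ w" .
qed

lemma map_eq_lookup_zip:
  assumes "distinct xs" "map f xs = es" "x \<in> set xs"
  shows "f x = the (map_of (zip xs es) x)"
  using assms by (auto simp: in_set_conv_nth map_of_zip_nth)

definition hash_pair_given ::
    "nat \<Rightarrow> nat \<Rightarrow> nat \<Rightarrow> ('a \<Rightarrow> nat) multiset \<Rightarrow> (nat \<Rightarrow> 'a \<Rightarrow> nat) \<Rightarrow> (('a \<Rightarrow> nat) \<times> ('a \<Rightarrow> nat)) pmf" where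
  "hash_pair_given c l m F g =
     do {h1 \<leftarrow> hash_given c l m F g; h2 \<leftarrow> hash_given c l m F g; return_pmf (h1, h2)}"

lemma prob_edge_list_le:
  assumes F: "indep_hash_family (2 * k) m U F" and U: "finite U" "2 * k \<le> card U"
    and xs: "distinct xs" "set xs \<subseteq> U"
    and j: "j \<in> {1..c}" "g j \<in> set xs \<rightarrow> {..<l}" "card (set xs) - card (g j ` set xs) \<le> k" and m: "m > 0"
    and W: "finite W"
  shows "measure_pmf.prob (hash_pair_given c l m F g)
      {(h1, h2). map (\<lambda>x. (h1 x, h2 x)) xs \<in> W} \<le> real (card W) * (1 / real m ^ (2 * length xs))"
proof (rule prob_UNION_le[OF W])
  fix p :: "('a \<Rightarrow> nat) \<times> ('a \<Rightarrow> nat)" assume "p \<in> {(h1, h2). map (\<lambda>x. (h1 x, h2 x)) xs \<in> W}"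
  then obtain h1 h2 where p: "p = (h1, h2)" "map (\<lambda>x. (h1 x, h2 x)) xs \<in> W" by auto
  show "\<exists>es\<in>W. p \<in> {(h1, h2). \<forall>x\<in>set xs. (h1 x, h2 x) = the (map_of (zip xs es) x)}"
    by (rule bexI[OF _ p(2)]) (use map_eq_lookup_zip[OF xs(1) refl, of _ "\<lambda>x. (h1 x, h2 x)"] p(1) in auto)
next
  fix es assume "es \<in> W"
  show "measure_pmf.prob (hash_pair_given c l m F g)
      {(h1, h2). \<forall>x\<in>set xs. (h1 x, h2 x) = the (map_of (zip xs es) x)} \<le> 1 / real m ^ (2 * length xs)"
    using prob_hash_pair_le[where g = g and j = j, OF F U xs(2) j m] distinct_card[OF xs(1)]
    by (simp add: hash_pair_given_def)
qed

section \<open>The union bound for fixed hash families and table sizes\<close>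

context
  fixes k c l m n s :: nat and U S :: "'a set" and F G :: "('a \<Rightarrow> nat) multiset"
  assumes F: "indep_hash_family (2 * k) m U F" and G: "indep_hash_family (2 * k) l U G"
    and U: "finite U" "2 * k \<le> card U" and S: "S \<subseteq> U" "card S = n"
    and k: "k \<ge> 1" and c: "c \<ge> 1" and m: "m > 0" and l: "l > 0"
begin

definition gs_pmf :: "(nat \<Rightarrow> 'a \<Rightarrow> nat) pmf" where
  "gs_pmf = Pi_pmf {1..c} undefined (\<lambda>_. pmf_of_multiset G)"

text \<open>Whether a key list is usable depends on \<open>g\<close>, which \<open>Z_pmf\<close>
  does not return; here it stays visible.\<close>

definition joint_pmf where
  "joint_pmf = do {g \<leftarrow> gs_pmf; p \<leftarrow> hash_pair_given c l m F g; return_pmf (g, p)}"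

lemma Z_pmf_joint: "Z_pmf c l m F G = map_pmf snd joint_pmf"
  by (simp add: Z_pmf_conv joint_pmf_def hash_pair_given_def gs_pmf_def map_bind_pmf bind_return_pmf')

definition good :: "'a list \<Rightarrow> (nat \<Rightarrow> 'a \<Rightarrow> nat) \<Rightarrow> bool" where
  "good xs g \<longleftrightarrow> (\<exists>j\<in>{1..c}. card (set xs) - card (g j ` set xs) \<le> k)"

text \<open>Not the negation of \<open>good\<close>: both hold exactly when the smallest deficiency
  equals \<open>k\<close>, as for the critical suffix.\<close>

definition deficient :: "'a list \<Rightarrow> (nat \<Rightarrow> 'a \<Rightarrow> nat) \<Rightarrow> bool" where
  "deficient xs g \<longleftrightarrow> (\<forall>j\<in>{1..c}. k \<le> card (set xs) - card (g j ` set xs))"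

lemma gs_range:
  assumes "g \<in> set_pmf gs_pmf" "j \<in> {1..c}" "x \<in> U"
  shows "g j x < l"
proof -
  have "g j \<in> set_pmf (pmf_of_multiset G)"
    using assms by (auto simp: gs_pmf_def set_Pi_pmf PiE_dflt_def)
  then show ?thesis using G assms(3) by (auto simp: indep_hash_family_def)
qed

text \<open>For a good list the bound given \<open>g\<close> is the same for all \<open>g\<close>,
  so the probability of a further condition \<open>A\<close> on \<open>g\<close> enters as a
  factor.\<close>

lemma prob_joint_le:
  assumes xs: "distinct xs" "set xs \<subseteq> S" and W: "finite W"
  shows "measure_pmf.prob joint_pmf
     {(g, h1, h2). A g \<and> good xs g \<and> map (\<lambda>x. (h1 x, h2 x)) xs \<in> W}
     \<le> measure_pmf.prob gs_pmf {g. A g} * (real (card W) * (1 / real m ^ (2 * length xs)))"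
  unfolding joint_pmf_def
proof (rule prob_bind_le_times)
  fix g assume g: "g \<in> set_pmf gs_pmf"
  let ?E = "{(g, h1, h2). A g \<and> good xs g \<and> map (\<lambda>x. (h1 x, h2 x)) xs \<in> W}"
  have Q: "measure_pmf.prob (bind_pmf (hash_pair_given c l m F g) (\<lambda>p. return_pmf (g, p))) ?E =
      measure_pmf.prob (hash_pair_given c l m F g) {p. (g, p) \<in> ?E}"
    by (simp add: map_pmf_def[symmetric] vimage_def)
  {
    assume "g \<notin> {g. A g}"
    then have emp: "{p. (g, p) \<in> ?E} = {}" by auto
    show "measure_pmf.prob (bind_pmf (hash_pair_given c l m F g) (\<lambda>p. return_pmf (g, p))) ?E = 0"
      unfolding Q emp by simp
  }
  show "measure_pmf.prob (bind_pmf (hash_pair_given c l m F g) (\<lambda>p. return_pmf (g, p))) ?E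
      \<le> real (card W) * (1 / real m ^ (2 * length xs))"
  proof (cases "good xs g")
    case False
    then have emp: "{p. (g, p) \<in> ?E} = {}" by auto
    show ?thesis unfolding Q emp by simp
  next
    case True
    then obtain j where j: "j \<in> {1..c}" "card (set xs) - card (g j ` set xs) \<le> k"
      by (auto simp: good_def)
    have gj: "g j \<in> set xs \<rightarrow> {..<l}" using gs_range[OF g j(1)] xs S by auto
    have "measure_pmf.prob (hash_pair_given c l m F g) {p. (g, p) \<in> ?E} \<le>
        measure_pmf.prob (hash_pair_given c l m F g) {(h1, h2). map (\<lambda>x. (h1 x, h2 x)) xs \<in> W}"
      by (intro measure_pmf.finite_measure_mono) auto
    also have "\<dots> \<le> real (card W) * (1 / real m ^ (2 * length xs))"
      using prob_edge_list_le[where g = g and j = j, OF F U xs(1) _ j(1) gj j(2) m W] xs(2) S(1) by auto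
    finally show ?thesis unfolding Q .
  qed
qed simp

definition key_lists :: "nat \<Rightarrow> 'a list set" where
  "key_lists t = {xs. set xs \<subseteq> S \<and> length xs = t \<and> distinct xs}"

lemma finite_S: "finite S"
  using S U finite_subset by blast

lemma key_lists: "finite (key_lists t)" "card (key_lists t) \<le> n ^ t"
proof -
  have "key_lists t \<subseteq> {xs. set xs \<subseteq> S \<and> length xs = t}" by (auto simp: key_lists_def)
  moreover have "finite {xs. set xs \<subseteq> S \<and> length xs = t}" "card {xs. set xs \<subseteq> S \<and> length xs = t} = n ^ t"
    using finite_S S by (simp_all add: finite_lists_length_eq card_lists_length_eq)
  ultimately show "finite (key_lists t)" "card (key_lists t) \<le> n ^ t"
    using finite_subset card_mono by metis+
qed

text \<open>Written with addition so that the set is empty for \<open>t < s + 1\<close>; truncated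
  subtraction would admit zero vertices there.\<close>

definition full_traces :: "nat \<Rightarrow> (nat \<times> nat) list set" where
  "full_traces t = traces m (3 * (s + 1)) t {v. v + (s + 1) = t}"

definition partial_traces :: "nat \<Rightarrow> (nat \<times> nat) list set" where
  "partial_traces t = traces m (3 * (s + 1)) t {..t + 1}"

definition witness :: "'a list \<Rightarrow> ((nat \<Rightarrow> 'a \<Rightarrow> nat) \<times> ('a \<Rightarrow> nat) \<times> ('a \<Rightarrow> nat)) set" where
  "witness xs =
     {(g, h1, h2). good xs g \<and> map (\<lambda>x. (h1 x, h2 x)) xs \<in> full_traces (length xs)} \<union>
     {(g, h1, h2). deficient xs g \<and> good xs g \<and> map (\<lambda>x. (h1 x, h2 x)) xs \<in> partial_traces (length xs)}"

lemma Z_hash_less: "Z_hash c m f g z x < m"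
  using m by (simp add: Z_hash_def)

lemma large_excess_witness:
  assumes ex: "excess (cuckoo_graph m S h1 h2) \<ge> s + 1" and h: "\<And>x. h1 x < m" "\<And>x. h2 x < m"
  shows "\<exists>t\<in>{1..n}. \<exists>xs\<in>key_lists t. (g, h1, h2) \<in> witness xs"
proof -
  obtain xs q us where xs: "distinct xs" "set xs \<subseteq> S" and b: "build m q (map (\<lambda>x. (h1 x, h2 x)) xs) us"
     "length us + (s + 1) = length xs" "q \<le> 3 * (s + 1)"
    using excess_build[OF finite_S _ _ ex] h by blast
  show ?thesis
  proof (cases "good xs g")
    case True
    have "length xs \<le> n" using xs finite_S S(2) by (metis card_mono distinct_card)
    then have "length xs \<in> {1..n}" using b(2) by auto
    moreover have "map (\<lambda>x. (h1 x, h2 x)) xs \<in> full_traces (length xs)"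
      using b unfolding full_traces_def traces_def by auto
    ultimately show ?thesis using xs True unfolding witness_def key_lists_def by blast
  next
    case False
    then have "\<forall>j\<in>{1..c}. k \<le> card (set xs) - card (g j ` set xs)" by (auto simp: good_def)
    then obtain i where i: "drop i xs \<noteq> []" "deficient (drop i xs) g" "good (drop i xs) g"
      using critical_suffix[OF xs(1) k, of "{1..c}" g] c unfolding good_def deficient_def by auto
    let ?ys = "drop i xs"
    have ys: "distinct ?ys" "set ?ys \<subseteq> S" using xs set_drop_subset by fastforce+
    have "length ?ys \<le> n" using ys finite_S S(2) by (metis card_mono distinct_card)
    moreover have "length ?ys \<ge> 1" using i(1) by (cases ?ys) auto
    ultimately have "length ?ys \<in> {1..n}" by simp
    \<comment> \<open>Of the structure of \<open>xs\<close> the suffix keeps its generation by at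
      most \<open>q\<close> moves, hence at most \<open>t' + 1\<close> vertices for length
      \<open>t'\<close>.\<close>
    moreover obtain q' us' where q': "q' \<le> q" "build m q' (map (\<lambda>x. (h1 x, h2 x)) ?ys) us'"
      using build_drop[OF b(1), of i] by (auto simp: drop_map)
    then have "map (\<lambda>x. (h1 x, h2 x)) ?ys \<in> partial_traces (length ?ys)"
      using b(3) build_length[OF q'(2)] unfolding partial_traces_def traces_def
      by (intro CollectI exI[of _ q'] exI[of _ us']) auto
    ultimately show ?thesis using ys i(2,3) unfolding witness_def key_lists_def by blast
  qed
qed

lemma prob_witness_le:
  assumes "xs \<in> key_lists t"
  shows "measure_pmf.prob joint_pmf (witness xs) \<le> real (card (full_traces t)) / real m ^ (2 * t) +
     (real t ^ (2 * k) / real l ^ k) ^ c * (real (card (partial_traces t)) / real m ^ (2 * t))"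
proof -
  have xs: "distinct xs" "set xs \<subseteq> S" "length xs = t" using assms by (auto simp: key_lists_def)
  have "finite {v. v + (s + 1) = t}" by (rule finite_subset[of _ "{..t}"]) auto
  then have fin1: "finite (full_traces t)"
    unfolding full_traces_def by (rule card_traces(1)[where w = t]) (use m in auto)
  have fin2: "finite (partial_traces t)"
    unfolding partial_traces_def by (rule card_traces(1)[where w = "t + 1"]) (use m in auto)
  have "measure_pmf.prob gs_pmf {g. deficient xs g} \<le> (real (card (set xs)) ^ (2 * k) / real l ^ k) ^ c"
    unfolding gs_pmf_def deficient_def by (rule prob_all_deficient_le[OF G U l]) (use xs S in auto)
  then have d: "measure_pmf.prob gs_pmf {g. deficient xs g} \<le> (real t ^ (2 * k) / real l ^ k) ^ c"
    using xs by (simp add: distinct_card)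
  let ?E1 = "{(g, h1, h2). good xs g \<and> map (\<lambda>x. (h1 x, h2 x)) xs \<in> full_traces t}"
  let ?E2 = "{(g, h1, h2). deficient xs g \<and> good xs g \<and> map (\<lambda>x. (h1 x, h2 x)) xs \<in> partial_traces t}"
  have "measure_pmf.prob joint_pmf (witness xs) \<le>
      measure_pmf.prob joint_pmf ?E1 + measure_pmf.prob joint_pmf ?E2"
    unfolding witness_def xs(3) by (rule measure_Un_le) auto
  moreover have "measure_pmf.prob joint_pmf ?E1 \<le> real (card (full_traces t)) * (1 / real m ^ (2 * t))"
    using prob_joint_le[OF xs(1,2) fin1, of "\<lambda>_. True"] by (simp add: xs(3))
  moreover have "measure_pmf.prob joint_pmf ?E2 \<le>
      measure_pmf.prob gs_pmf {g. deficient xs g} * (real (card (partial_traces t)) * (1 / real m ^ (2 * t)))"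
    using prob_joint_le[OF xs(1,2) fin2, of "deficient xs"] by (simp only: xs(3))
  moreover have "\<dots> \<le> (real t ^ (2 * k) / real l ^ k) ^ c * (real (card (partial_traces t)) * (1 / real m ^ (2 * t)))"
    by (intro mult_right_mono d) auto
  ultimately show ?thesis by simp
qed

lemma prob_excess_le_sum:
  "measure_pmf.prob (Z_pmf c l m F G) {(h1, h2). excess (cuckoo_graph m S h1 h2) \<ge> s + 1} \<le>
   (\<Sum>t=1..n. real n ^ t * (real (card (full_traces t)) / real m ^ (2 * t) +
     (real t ^ (2 * k) / real l ^ k) ^ c * (real (card (partial_traces t)) / real m ^ (2 * t))))"
  (is "?lhs \<le> (\<Sum>t=1..n. real n ^ t * ?b t)")
proof -
  have "?lhs = measure_pmf.prob joint_pmf {(g, h1, h2). excess (cuckoo_graph m S h1 h2) \<ge> s + 1}"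
    unfolding Z_pmf_joint measure_map_pmf by (rule arg_cong[where f = "measure_pmf.prob _"]) auto
  also have "\<dots> \<le> measure_pmf.prob joint_pmf (\<Union>t\<in>{1..n}. \<Union>xs\<in>key_lists t. witness xs)"
  proof (rule prob_mono_on_support)
    fix w assume w: "w \<in> set_pmf joint_pmf" "w \<in> {(g, h1, h2). excess (cuckoo_graph m S h1 h2) \<ge> s + 1}"
    obtain g h1 h2 where wg: "w = (g, h1, h2)" by (cases w)
    have "h1 x < m" "h2 x < m" for x
      using w(1) Z_hash_less by (auto simp: wg joint_pmf_def hash_pair_given_def hash_given_def)
    then show "w \<in> (\<Union>t\<in>{1..n}. \<Union>xs\<in>key_lists t. witness xs)"
      using large_excess_witness[of h1 h2 g] w(2) wg by auto
  qed
  also have "\<dots> \<le> (\<Sum>t=1..n. measure_pmf.prob joint_pmf (\<Union>xs\<in>key_lists t. witness xs))"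
    by (rule measure_UNION_le) auto
  also have "\<dots> \<le> (\<Sum>t=1..n. real n ^ t * ?b t)"
  proof (rule sum_mono)
    fix t
    have "measure_pmf.prob joint_pmf (\<Union>xs\<in>key_lists t. witness xs) \<le>
        (\<Sum>xs\<in>key_lists t. measure_pmf.prob joint_pmf (witness xs))"
      using key_lists by (intro measure_UNION_le) auto
    also have "\<dots> \<le> (\<Sum>xs\<in>key_lists t. ?b t)" by (intro sum_mono prob_witness_le)
    also have "\<dots> = real (card (key_lists t)) * ?b t" by simp
    also have "\<dots> \<le> real n ^ t * ?b t"
      using key_lists(2)[of t] by (intro mult_right_mono) (simp_all flip: of_nat_power)
    finally show "measure_pmf.prob joint_pmf (\<Union>xs\<in>key_lists t. witness xs) \<le> real n ^ t * ?b t" .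
  qed
  finally show ?thesis .
qed

text \<open>With \<open>m ^ (t - s - 1)\<close> traces, the term
  \<open>n ^ t * m ^ (t - s - 1) / m ^ (2 * t)\<close> is \<open>(n / m) ^ t / m ^ (s + 1)\<close>,
  and \<open>n \<le> m\<close>.\<close>

lemma full_term_le:
  assumes \<rho>: "0 < \<rho>" "real n \<le> \<rho> * real m" and "n \<le> m" "n \<ge> 1"
  shows "real n ^ t * (real (card (full_traces t)) / real m ^ (2 * t)) \<le>
    real (3 * (s + 1) + 1) * real (t + 2) ^ (9 * (s + 1)) * \<rho> ^ t / real n ^ (s + 1)"
proof (cases "s + 1 \<le> t")
  case False
  then have "full_traces t = {}" by (auto simp: full_traces_def traces_def)
  then show ?thesis using \<rho> by simp
next
  case True
  define v where "v = t - (s + 1)"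
  have t: "t = v + (s + 1)" using True by (simp add: v_def)
  have V: "{v. v + (s + 1) = t} = {v}" using t by auto
  let ?Q = "real (3 * (s + 1) + 1) * real (t + 2) ^ (9 * (s + 1))"
  have "card (full_traces t) \<le> (3 * (s + 1) + 1) * card {v} * (t + 2) ^ (3 * (3 * (s + 1))) * m ^ v"
    unfolding full_traces_def V by (rule card_traces(2)) (use m in auto)
  then have "card (full_traces t) \<le> (3 * (s + 1) + 1) * (t + 2) ^ (9 * (s + 1)) * m ^ v"
    by (simp add: mult.assoc)
  then have "real (card (full_traces t)) \<le> real ((3 * (s + 1) + 1) * (t + 2) ^ (9 * (s + 1)) * m ^ v)"
    by (rule of_nat_mono)
  then have card: "real (card (full_traces t)) \<le> ?Q * real m ^ v" by simp
  have "real n ^ t * (real (card (full_traces t)) / real m ^ (2 * t)) \<le>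
      real n ^ t * (?Q * real m ^ v / real m ^ (2 * t))"
    by (intro mult_left_mono divide_right_mono card) auto
  also have "\<dots> = ?Q * ((real n / real m) ^ t * (1 / real m ^ (s + 1)))"
  proof -
    have "real m ^ (2 * t) = real m ^ t * (real m ^ v * real m ^ (s + 1))"
      unfolding t mult_2 power_add by simp
    then show ?thesis using m by (simp add: power_divide)
  qed
  also have "\<dots> \<le> ?Q * (\<rho> ^ t * (1 / real n ^ (s + 1)))"
  proof (intro mult_left_mono mult_mono power_mono)
    show "real n / real m \<le> \<rho>" using \<rho> m by (simp add: divide_le_eq)
    show "1 / real m ^ (s + 1) \<le> 1 / real n ^ (s + 1)"
      using assms(3,4) by (intro divide_left_mono power_mono mult_pos_pos zero_less_power) auto
  qed (use \<rho> in auto)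
  finally show ?thesis by simp
qed

text \<open>Here \<open>n ^ t * m ^ (t + 1) / m ^ (2 * t)\<close> is
  \<open>n * (n / m) ^ (t - 1)\<close>. Giving up one factor \<open>n / m\<close> matters because
  \<open>m\<close> has no upper bound in terms of \<open>n\<close>; it costs
  \<open>1 / \<rho>\<close>. The deficiency supplies \<open>2 ^ (k * c) / n ^ (s + 2)\<close> and
  the exponent \<open>2 * k * c\<close>; the extra \<open>1\<close> in the exponent counts the
  \<open>t + 2\<close> possible numbers of vertices.\<close>

lemma partial_term_le:
  assumes \<rho>: "0 < \<rho>" "real n \<le> \<rho> * real m" and "n \<ge> 1" "t \<ge> 1"
    and l_large: "real n ^ (s + 2) \<le> 2 ^ (k * c) * real l ^ (k * c)"
  shows "real n ^ t * ((real t ^ (2 * k) / real l ^ k) ^ c * (real (card (partial_traces t)) / real m ^ (2 * t))) \<le>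
    2 ^ (k * c) / \<rho> * (real (3 * (s + 1) + 1) * real (t + 2) ^ (9 * (s + 1) + 1 + 2 * k * c) * \<rho> ^ t / real n ^ (s + 1))"
proof -
  obtain u where t: "t = Suc u" using \<open>t \<ge> 1\<close> by (cases t) auto
  let ?Q = "real (3 * (s + 1) + 1) * real (t + 2) ^ (9 * (s + 1) + 1)"
  have "card (partial_traces t) \<le> (3 * (s + 1) + 1) * card {..t + 1} * (t + 2) ^ (3 * (3 * (s + 1))) * m ^ (t + 1)"
    unfolding partial_traces_def by (rule card_traces(2)) (use m in auto)
  also have "\<dots> = (3 * (s + 1) + 1) * (t + 2) ^ (9 * (s + 1) + 1) * m ^ (t + 1)"
  proof -
    have eqs: "card {..t + 1} = t + 2" "3 * (3 * (s + 1)) = 9 * (s + 1)" by simp_all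
    have pow: "(t + 2) ^ (9 * (s + 1) + 1) = (t + 2) * (t + 2) ^ (9 * (s + 1))"
      by (subst power_add) (simp only: power_one_right mult.commute)
    show ?thesis by (simp only: eqs pow mult.assoc)
  qed
  finally have "real (card (partial_traces t)) \<le> real ((3 * (s + 1) + 1) * (t + 2) ^ (9 * (s + 1) + 1) * m ^ (t + 1))"
    by (rule of_nat_mono)
  then have card: "real (card (partial_traces t)) \<le> ?Q * real m ^ (t + 1)" by simp
  have lpow: "(real t ^ (2 * k) / real l ^ k) ^ c \<le> real (t + 2) ^ (2 * k * c) * (2 ^ (k * c) / real n ^ (s + 2))"
  proof -
    have "(real t ^ (2 * k) / real l ^ k) ^ c = real t ^ (2 * k * c) * (1 / real l ^ (k * c))"
      by (simp add: power_divide power_mult)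
    also have "\<dots> \<le> real (t + 2) ^ (2 * k * c) * (2 ^ (k * c) / real n ^ (s + 2))"
    proof (intro mult_mono power_mono)
      show "1 / real l ^ (k * c) \<le> 2 ^ (k * c) / real n ^ (s + 2)"
        using l_large l \<open>n \<ge> 1\<close> by (subst frac_le_eq) (auto simp: divide_le_0_iff mult_ac)
    qed auto
    finally show ?thesis .
  qed
  have "real n ^ t * ((real t ^ (2 * k) / real l ^ k) ^ c * (real (card (partial_traces t)) / real m ^ (2 * t))) \<le>
      real n ^ t * ((real (t + 2) ^ (2 * k * c) * (2 ^ (k * c) / real n ^ (s + 2))) *
        (?Q * real m ^ (t + 1) / real m ^ (2 * t)))"
    by (intro mult_left_mono mult_mono divide_right_mono card lpow) auto
  also have "\<dots> = 2 ^ (k * c) * (?Q * real (t + 2) ^ (2 * k * c)) * ((real n / real m) ^ u / real n ^ (s + 1))"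
  proof -
    have "real m ^ (2 * t) = real m ^ u * real m ^ (t + 1)"
      unfolding t mult_2 power_add by (simp add: mult_ac)
    then show ?thesis using m \<open>n \<ge> 1\<close> by (simp add: t power_divide field_simps)
  qed
  also have "\<dots> \<le> 2 ^ (k * c) * (?Q * real (t + 2) ^ (2 * k * c)) * (\<rho> ^ u / real n ^ (s + 1))"
  proof (intro mult_left_mono divide_right_mono power_mono)
    show "real n / real m \<le> \<rho>" using \<rho> m by (simp add: divide_le_eq)
  qed auto
  also have "\<rho> ^ u = \<rho> ^ t / \<rho>" using \<rho> by (simp add: t)
  finally show ?thesis by (simp add: power_add mult_ac)
qed

lemma prob_excess_le:
  assumes \<rho>: "0 < \<rho>" "\<rho> < 1" "real n \<le> \<rho> * real m" and n: "n \<ge> 1"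
    and l_large: "real n ^ (s + 2) \<le> 2 ^ (k * c) * real l ^ (k * c)"
  shows "measure_pmf.prob (Z_pmf c l m F G) {(h1, h2). excess (cuckoo_graph m S h1 h2) \<ge> s + 1} \<le>
     (1 + 2 ^ (k * c) / \<rho>) * real (3 * (s + 1) + 1) *
     (\<Sum>t. real (t + 2) ^ (9 * (s + 1) + 1 + 2 * k * c) * \<rho> ^ t) / real n ^ (s + 1)"
proof -
  let ?d = "9 * (s + 1) + 1 + 2 * k * c"
  let ?f = "\<lambda>t. real (t + 2) ^ ?d * \<rho> ^ t"
  let ?C = "(1 + 2 ^ (k * c) / \<rho>) * real (3 * (s + 1) + 1) / real n ^ (s + 1)"
  have "\<rho> * real m \<le> real m" using \<rho> by (simp add: mult_left_le_one_le)
  then have nm: "n \<le> m" using \<rho>(3) by linarith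
  have C0: "?C \<ge> 0" using \<rho> by simp
  have sm: "summable ?f" by (rule summable_shifted_power_times_geometric[OF \<rho>(1,2)])
  have "measure_pmf.prob (Z_pmf c l m F G) {(h1, h2). excess (cuckoo_graph m S h1 h2) \<ge> s + 1} \<le>
      (\<Sum>t=1..n. real n ^ t * (real (card (full_traces t)) / real m ^ (2 * t) +
     (real t ^ (2 * k) / real l ^ k) ^ c * (real (card (partial_traces t)) / real m ^ (2 * t))))"
    by (rule prob_excess_le_sum)
  also have "\<dots> \<le> (\<Sum>t=1..n. ?C * ?f t)"
  proof (rule sum_mono)
    fix t assume "t \<in> {1..n}"
    have "real (t + 2) ^ (9 * (s + 1)) \<le> real (t + 2) ^ ?d" by (intro power_increasing) auto
    then have "real (3 * (s + 1) + 1) * real (t + 2) ^ (9 * (s + 1)) * \<rho> ^ t / real n ^ (s + 1) \<le>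
        real (3 * (s + 1) + 1) * real (t + 2) ^ ?d * \<rho> ^ t / real n ^ (s + 1)"
      using \<rho> by (intro divide_right_mono mult_right_mono mult_left_mono) auto
    then have "real n ^ t * (real (card (full_traces t)) / real m ^ (2 * t)) \<le>
        real (3 * (s + 1) + 1) * real (t + 2) ^ ?d * \<rho> ^ t / real n ^ (s + 1)"
      using full_term_le[OF \<rho>(1,3) nm n, of t] by linarith
    moreover have "real n ^ t * ((real t ^ (2 * k) / real l ^ k) ^ c * (real (card (partial_traces t)) / real m ^ (2 * t)))
       \<le> 2 ^ (k * c) / \<rho> * (real (3 * (s + 1) + 1) * real (t + 2) ^ ?d * \<rho> ^ t / real n ^ (s + 1))"
      by (rule partial_term_le[OF \<rho>(1,3) n _ l_large]) (use \<open>t \<in> {1..n}\<close> in simp)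
    ultimately have "real n ^ t * (real (card (full_traces t)) / real m ^ (2 * t)) +
        real n ^ t * ((real t ^ (2 * k) / real l ^ k) ^ c * (real (card (partial_traces t)) / real m ^ (2 * t)))
       \<le> (1 + 2 ^ (k * c) / \<rho>) * (real (3 * (s + 1) + 1) * real (t + 2) ^ ?d * \<rho> ^ t / real n ^ (s + 1))"
      unfolding distrib_right mult_1_left by (rule add_mono)
    then show "real n ^ t * (real (card (full_traces t)) / real m ^ (2 * t) +
        (real t ^ (2 * k) / real l ^ k) ^ c * (real (card (partial_traces t)) / real m ^ (2 * t))) \<le> ?C * ?f t"
      unfolding distrib_left[of "real n ^ t"] by (simp only: times_divide_eq_left times_divide_eq_right mult.assoc)
  qed
  also have "\<dots> = ?C * (\<Sum>t=1..n. ?f t)" by (rule sum_distrib_left[symmetric])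
  also have "\<dots> \<le> ?C * (\<Sum>t. ?f t)"
    using \<rho> by (intro mult_left_mono[OF _ C0] sum_le_suminf[OF sm]) auto
  finally show ?thesis by simp
qed

end

text \<open>Rounding loses at most a factor \<open>2\<close> in \<open>l\<close>, whence
  \<open>2 ^ (k * c)\<close>; the bound on \<open>c\<close> makes the exponent \<delta> k c at least
  \<open>s + 2\<close>.\<close>

lemma table_size_large:
  assumes "0 < \<delta>" "k \<ge> 1" "real c \<ge> (real s + 2) / (\<delta> * real k)" "n \<ge> 1"
    and l: "l \<in> {nat \<lfloor>real n powr \<delta>\<rfloor>, nat \<lceil>real n powr \<delta>\<rceil>}"
  shows "l > 0" "real n ^ (s + 2) \<le> 2 ^ (k * c) * real l ^ (k * c)"
proof -
  let ?y = "real n powr \<delta>"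
  have y: "?y \<ge> 1" using assms by (simp add: ge_one_powr_ge_zero)
  have "\<lfloor>?y\<rfloor> \<ge> 1" "real_of_int \<lfloor>?y\<rfloor> > ?y - 1" using y by (simp, linarith)
  then have "real (nat \<lfloor>?y\<rfloor>) \<ge> ?y / 2" "nat \<lfloor>?y\<rfloor> > 0" by linarith+
  moreover have "nat \<lfloor>?y\<rfloor> \<le> l"
  proof -
    have "nat \<lfloor>?y\<rfloor> \<le> nat \<lceil>?y\<rceil>" by linarith
    then show ?thesis using l by (metis insertE order_refl singletonD)
  qed
  ultimately have "real l \<ge> ?y / 2" and l0: "l > 0" by linarith+
  then have yl: "?y \<le> 2 * real l" by simp
  show "l > 0" by (rule l0)
  have "real s + 2 \<le> \<delta> * real (k * c)"
    using assms(1-3) by (simp add: divide_le_eq mult_ac)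
  then have "real n powr (real (s + 2)) \<le> real n powr (\<delta> * real (k * c))"
    using assms(4) by (intro powr_mono) auto
  moreover have "real n powr (real (s + 2)) = real n ^ (s + 2)"
    using assms(4) by (intro powr_realpow) simp
  moreover have "real n powr (\<delta> * real (k * c)) = ?y ^ (k * c)"
    using assms(4) by (subst powr_powr[symmetric], subst powr_realpow) auto
  ultimately have "real n ^ (s + 2) \<le> ?y ^ (k * c)" by (simp only:)
  also have "\<dots> \<le> (2 * real l) ^ (k * c)" using yl y by (intro power_mono) auto
  finally show "real n ^ (s + 2) \<le> 2 ^ (k * c) * real l ^ (k * c)" by (simp add: power_mult_distrib)
qed

theorem theorem1:
  fixes \<epsilon> \<delta> :: real and s k c :: nat
  assumes "\<epsilon> > 0" and "0 < \<delta>" and "\<delta> < 1" and "k \<ge> 1" and "c \<ge> 1"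
    and "real c \<ge> (real s + 2) / (\<delta> * real k)"
  shows "\<exists>B::real. \<forall>(U :: 'a set) (S :: 'a set) (n::nat) (m::nat) (l::nat) F G.
           finite U \<and> S \<subseteq> U \<and> card S = n \<and> n \<ge> 1 \<and> real m \<ge> (1 + \<epsilon>) * real n \<and>
           l \<in> {nat \<lfloor>real n powr \<delta>\<rfloor>, nat \<lceil>real n powr \<delta>\<rceil>} \<and>
           indep_hash_family (2 * k) m U F \<and> indep_hash_family (2 * k) l U G \<longrightarrow>
           measure_pmf.prob (Z_pmf c l m F G)
             {(h1, h2). excess (cuckoo_graph m S h1 h2) \<ge> s + 1} \<le> B / real n ^ (s + 1)"
proof -
  define \<rho> where "\<rho> = 1 / (1 + \<epsilon>)"
  have \<rho>: "0 < \<rho>" "\<rho> < 1" using assms(1) by (simp_all add: \<rho>_def)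
  define B1 where "B1 = (1 + 2 ^ (k * c) / \<rho>) * real (3 * (s + 1) + 1) *
     (\<Sum>t. real (t + 2) ^ (9 * (s + 1) + 1 + 2 * k * c) * \<rho> ^ t)"
  \<comment> \<open>For \<open>n < 2 * k\<close> the universe may have fewer than
    \<open>2 * k\<close> keys, and \<open>2 * k\<close>-wise independence then says nothing about
    them. The constant makes the bound at least \<open>1\<close> for these \<open>n\<close>.\<close>
  define B2 where "B2 = real (2 * k) ^ (s + 1)"
  show ?thesis
  proof (rule exI[of _ "max B1 B2"], intro allI impI, elim conjE)
    fix U S :: "'a set" and n m l :: nat and F G :: "('a \<Rightarrow> nat) multiset"
    assume *: "finite U" "S \<subseteq> U" "card S = n" "n \<ge> 1" "real m \<ge> (1 + \<epsilon>) * real n"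
      "l \<in> {nat \<lfloor>real n powr \<delta>\<rfloor>, nat \<lceil>real n powr \<delta>\<rceil>}"
      "indep_hash_family (2 * k) m U F" "indep_hash_family (2 * k) l U G"
    let ?P = "measure_pmf.prob (Z_pmf c l m F G) {(h1, h2). excess (cuckoo_graph m S h1 h2) \<ge> s + 1}"
    have n0: "real n > 0" using *(4) by simp
    have "?P \<le> B1 / real n ^ (s + 1) \<or> ?P \<le> B2 / real n ^ (s + 1)"
    proof (cases "n < 2 * k")
      case True
      then have "real n ^ (s + 1) \<le> B2" unfolding B2_def by (intro power_mono) auto
      then have "1 \<le> B2 / real n ^ (s + 1)" using n0 by (subst le_divide_eq_1_pos) auto
      moreover have "?P \<le> 1" by simp
      ultimately have "?P \<le> B2 / real n ^ (s + 1)" by linarith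
      then show ?thesis ..
    next
      case False
      have "n \<le> card U" using *(1-3) card_mono by metis
      then have U: "2 * k \<le> card U" using False by simp
      have nm: "real n \<le> \<rho> * real m"
        using *(5) assms(1) by (simp add: \<rho>_def field_simps)
      then have "m > 0" using n0 by (cases m) auto
      note lt = table_size_large[OF assms(2,4,6) *(4,6)]
      have "?P \<le> B1 / real n ^ (s + 1)"
        unfolding B1_def
        by (rule prob_excess_le[OF *(7,8,1) U *(2,3) assms(4,5) \<open>m > 0\<close> lt(1) \<rho> nm *(4) lt(2)])
      then show ?thesis ..
    qed
    moreover have "B1 / real n ^ (s + 1) \<le> max B1 B2 / real n ^ (s + 1)"
      "B2 / real n ^ (s + 1) \<le> max B1 B2 / real n ^ (s + 1)"
      by (intro divide_right_mono; simp)+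
    ultimately show "?P \<le> max B1 B2 / real n ^ (s + 1)" by linarith
  qed
qed

end
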